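(* Let $\kappa>0$ and let $\rho:\mathbb{R}\to\mathbb{R}$ be Lipschitz continuous with $|\rho(u)|^2=\lambda^2(\varsigma^2+u^2)$ for all $u\in\mathbb{R}$, where $\lambda\ne0$, $\varsigma\ge0$. Let $g(x)=|x|^{-a}$ with $a\in[0,1/2)$ and $\mu\equiv0$, and let $I(t,x)=\iint_{[0,t]\times\mathbb{R}}G_\kappa(t-s,x-y)\rho(u(s,y))W(ds,dy)$ be the stochastic integral part of the solution $u=J_0+I$. Then, in the neighborhood of the two characteristic lines $|x|=\kappa t$, the function $I$ mapping $\mathbb{R}_+\times\mathbb{R}$ into $L^p(\Omega)$, $p\ge2$, cannot be $\eta$-Hölder continuous either in space or in time with $\eta>\frac{1-2a}2$. That is: for every $p\ge2$, every $\eta>\frac{1-2a}{2}$, every point $(t_0,x_0)$ with $t_0>0$ and $|x_0|=\kappa t_0$, and every neighborhood $U$ of $(t_0,x_0)$ in $\mathbb{R}_+\times\mathbb{R}$, there is no constant $C<\infty$ such that $\|I(t,x)-I(t,x')\|_p\le C|x-x'|^\eta$ for all $(t,x),(t,x')\in U$, and there is no constant $C<\infty$ such that $\|I(t,x)-I(t',x)\|_p\le C|t-t'|^\eta$ for all $(t,x),(t',x)\in U$.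
   Context: $W$ is a space-time white noise on $\mathbb{R}_+\times\mathbb{R}$ (with $\mathbb{R}_+=[0,\infty)$), $(\mathcal F_t)$ its natural augmented filtration, stochastic integrals are in the sense of Walsh, $\|\cdot\|_p$ is the $L^p(\Omega)$-norm. $G_\kappa(t,x)=\frac12 1_{\{t\ge0\}}1_{[-\kappa t,\kappa t]}(x)$ and, here, $J_0(t,x)=\frac12(g(x+\kappa t)+g(x-\kappa t))$. A solution is an adapted, jointly measurable random field $u=J_0+I$ satisfying the integral equation such that $\int_0^t\int_{\mathbb{R}} G_\kappa^2(t-s,x-y)\|\rho(u(s,y))\|_2^2\,dy\,ds<\infty$ for all $t>0,x\in\mathbb{R}$ and $(t,x)\mapsto I(t,x)$ is continuous from $\mathbb{R}_+\times\mathbb{R}$ into $L^2(\Omega)$; such a solution exists and is unique up to versions ($J_0$ may be undefined or infinite on the characteristic lines, but $I(t,x)$ is defined for all $(t,x)$). *)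

theory Defs
  imports "HOL-Probability.Probability"
begin

definition Lp_norm :: "'a measure \<Rightarrow> real \<Rightarrow> ('a \<Rightarrow> real) \<Rightarrow> ennreal" where
  "Lp_norm M p X =
     (let m = \<integral>\<^sup>+ \<omega>. ennreal (\<bar>X \<omega>\<bar> powr p) \<partial>M
      in if m = \<infinity> then \<infinity> else ennreal (enn2real m powr (1 / p)))"

definition half_plane :: "(real \<times> real) set" where
  "half_plane = {0..} \<times> UNIV"

definition st_lebesgue :: "(real \<times> real) measure" where
  "st_lebesgue = restrict_space lborel half_plane"

section \<open>White noise and its filtration\<close>

text \<open>The normal law with mean \<open>0\<close> and standard deviation \<open>s \<ge> 0\<close> is written as the image of
  the standard normal law under multiplication by \<open>s\<close>, so that \<open>s = 0\<close> gives the Dirac mass.\<close>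

definition centered_gaussian :: "'a measure \<Rightarrow> ('a \<Rightarrow> real) \<Rightarrow> bool" where
  "centered_gaussian M X \<longleftrightarrow>
     X \<in> borel_measurable M \<and>
     (\<exists>s\<ge>0. distr M borel X = distr std_normal_distribution borel (\<lambda>z. s * z))"

definition centered_gaussian_process :: "'a measure \<Rightarrow> 'i set \<Rightarrow> ('i \<Rightarrow> 'a \<Rightarrow> real) \<Rightarrow> bool" where
  "centered_gaussian_process M T X \<longleftrightarrow>
     (\<forall>S c. finite S \<and> S \<subseteq> T \<longrightarrow> centered_gaussian M (\<lambda>\<omega>. \<Sum>i\<in>S. c i * X i \<omega>))"

definition finite_sets :: "'b measure \<Rightarrow> 'b set set" where
  "finite_sets N = {A \<in> sets N. emeasure N A < \<infinity>}"

definition space_time_white_noise ::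
    "'a measure \<Rightarrow> ((real \<times> real) set \<Rightarrow> 'a \<Rightarrow> real) \<Rightarrow> bool" where
  "space_time_white_noise M W \<longleftrightarrow>
     centered_gaussian_process M (finite_sets st_lebesgue) W \<and>
     (\<forall>A \<in> finite_sets st_lebesgue. \<forall>B \<in> finite_sets st_lebesgue.
        (\<integral>\<omega>. W A \<omega> * W B \<omega> \<partial>M) = measure st_lebesgue (A \<inter> B))"

definition noise_filtration ::
    "'a measure \<Rightarrow> ((real \<times> real) set \<Rightarrow> 'a \<Rightarrow> real) \<Rightarrow> real \<Rightarrow> 'a measure" where
  "noise_filtration M W t =
     sigma (space M)
       ({W ({0..s} \<times> A) -` B \<inter> space M | s A B.
           0 \<le> s \<and> s \<le> t \<and> A \<in> finite_sets lborel \<and> B \<in> sets borel} \<union> null_sets M)"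

section \<open>The Walsh integral\<close>

text \<open>A quadruple \<open>(a, b, A, X)\<close> stands for the elementary process
  \<open>X(\<omega>) 1_(a,b](s) 1_A(y)\<close>, a list of quadruples for the sum of its entries.\<close>

type_synonym 'a elementary = "real \<times> real \<times> real set \<times> ('a \<Rightarrow> real)"

fun is_elementary :: "'a measure \<Rightarrow> (real \<Rightarrow> 'a measure) \<Rightarrow> 'a elementary \<Rightarrow> bool" where
  "is_elementary M F (a, b, A, X) \<longleftrightarrow>
     0 \<le> a \<and> a < b \<and> A \<in> finite_sets lborel \<and>
     X \<in> borel_measurable (F a) \<and> (\<exists>c. \<forall>\<omega>\<in>space M. \<bar>X \<omega>\<bar> \<le> c)"

definition simple_process :: "'a elementary list \<Rightarrow> real \<Rightarrow> real \<Rightarrow> 'a \<Rightarrow> real" where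
  "simple_process es s y \<omega> =
     (\<Sum>(a, b, A, X)\<leftarrow>es. X \<omega> * indicator {a<..b} s * indicator A y)"

definition simple_integral ::
    "((real \<times> real) set \<Rightarrow> 'a \<Rightarrow> real) \<Rightarrow> 'a elementary list \<Rightarrow> 'a \<Rightarrow> real" where
  "simple_integral W es \<omega> = (\<Sum>(a, b, A, X)\<leftarrow>es. X \<omega> * W ({a<..b} \<times> A) \<omega>)"

definition jointly_measurable :: "'a measure \<Rightarrow> (real \<Rightarrow> real \<Rightarrow> 'a \<Rightarrow> real) \<Rightarrow> bool" where
  "jointly_measurable M f \<longleftrightarrow>
     (\<lambda>((s, y), \<omega>). f s y \<omega>) \<in> borel_measurable (st_lebesgue \<Otimes>\<^sub>M M)"

text \<open>The integral is determined only up to almost sure equality, so it is a relation: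
  \<open>Y\<close> is (a version of) the integral of \<open>f\<close> over \<open>[0,\<infinity>) \<times> \<real>\<close> if \<open>f\<close> is an \<open>L\<^sup>2\<close>-limit of simple
  predictable processes whose integrals converge to \<open>Y\<close> in \<open>L\<^sup>2(\<Omega>)\<close>.\<close>

definition has_walsh_integral ::
    "'a measure \<Rightarrow> ((real \<times> real) set \<Rightarrow> 'a \<Rightarrow> real) \<Rightarrow>
      (real \<Rightarrow> real \<Rightarrow> 'a \<Rightarrow> real) \<Rightarrow> ('a \<Rightarrow> real) \<Rightarrow> bool" where
  "has_walsh_integral M W f Y \<longleftrightarrow>
     jointly_measurable M f \<and> Y \<in> borel_measurable M \<and>
     (\<exists>es :: nat \<Rightarrow> 'a elementary list.
        (\<forall>n. \<forall>e\<in>set (es n). is_elementary M (noise_filtration M W) e) \<and>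
        (\<lambda>n. \<integral>\<^sup>+ ((s, y), \<omega>). ennreal ((f s y \<omega> - simple_process (es n) s y \<omega>)\<^sup>2)
               \<partial>(st_lebesgue \<Otimes>\<^sub>M M)) \<longlonglongrightarrow> 0 \<and>
        (\<lambda>n. \<integral>\<^sup>+ \<omega>. ennreal ((Y \<omega> - simple_integral W (es n) \<omega>)\<^sup>2) \<partial>M) \<longlonglongrightarrow> 0)"

section \<open>The stochastic wave equation with zero initial velocity\<close>

definition wave_kernel :: "real \<Rightarrow> real \<Rightarrow> real \<Rightarrow> real" where
  "wave_kernel \<kappa> t x = 1 / 2 * indicator {0..} t * indicator {- \<kappa> * t..\<kappa> * t} x"

text \<open>The initial position may take infinite values.\<close>

definition wave_homogeneous :: "real \<Rightarrow> (real \<Rightarrow> ereal) \<Rightarrow> real \<Rightarrow> real \<Rightarrow> ereal" where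
  "wave_homogeneous \<kappa> g t x = (g (x + \<kappa> * t) + g (x - \<kappa> * t)) / 2"

text \<open>\<open>I\<close> is the stochastic integral part of \<open>u\<close>. It is defined at every point of the half plane,
  while \<open>u = J\<^sub>0 + I\<close> is demanded only where \<open>J\<^sub>0\<close> is finite; elsewhere the value of \<open>u\<close> is
  an arbitrary real convention.\<close>

definition wave_solution ::
    "'a measure \<Rightarrow> ((real \<times> real) set \<Rightarrow> 'a \<Rightarrow> real) \<Rightarrow> real \<Rightarrow> (real \<Rightarrow> real) \<Rightarrow> (real \<Rightarrow> ereal) \<Rightarrow>
      (real \<Rightarrow> real \<Rightarrow> 'a \<Rightarrow> real) \<Rightarrow> (real \<Rightarrow> real \<Rightarrow> 'a \<Rightarrow> real) \<Rightarrow> bool" where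
  "wave_solution M W \<kappa> \<rho> g u I \<longleftrightarrow>
     (\<forall>t\<ge>0. \<forall>x. u t x \<in> borel_measurable (noise_filtration M W t)) \<and>
     jointly_measurable M u \<and>
     (\<forall>t>0. \<forall>x.
        (\<integral>\<^sup>+ s\<in>{0..t}. (\<integral>\<^sup>+ y. ennreal ((wave_kernel \<kappa> (t - s) (x - y))\<^sup>2) *
            (Lp_norm M 2 (\<lambda>\<omega>. \<rho> (u s y \<omega>)))\<^sup>2 \<partial>lborel) \<partial>lborel) < \<infinity>) \<and>
     (\<forall>t\<ge>0. \<forall>x. has_walsh_integral M W
        (\<lambda>s y \<omega>. indicator {0..t} s * wave_kernel \<kappa> (t - s) (x - y) * \<rho> (u s y \<omega>)) (I t x)) \<and>
     (\<forall>t\<ge>0. \<forall>x.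
        ((\<lambda>(t', x'). Lp_norm M 2 (\<lambda>\<omega>. I t' x' \<omega> - I t x \<omega>)) \<longlongrightarrow> 0) (at (t, x) within half_plane)) \<and>
     (\<forall>t\<ge>0. \<forall>x. \<bar>wave_homogeneous \<kappa> g t x\<bar> \<noteq> \<infinity> \<longrightarrow>
        (AE \<omega> in M. ereal (u t x \<omega>) = wave_homogeneous \<kappa> g t x + ereal (I t x \<omega>)))"

text \<open>The function \<open>|x|\<^sup>-\<^sup>a\<close>; the case distinction is needed because \<open>0 powr b = 0\<close> for every \<open>b\<close>.\<close>

definition abs_power_datum :: "real \<Rightarrow> real \<Rightarrow> ereal" where
  "abs_power_datum a x =
     (if a = 0 then 1 else if x = 0 then \<infinity> else ereal (\<bar>x\<bar> powr (- a)))"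

section \<open>Hoelder continuity in space and in time\<close>

definition holder_in_space ::
    "'a measure \<Rightarrow> real \<Rightarrow> real \<Rightarrow> (real \<times> real) set \<Rightarrow> (real \<Rightarrow> real \<Rightarrow> 'a \<Rightarrow> real) \<Rightarrow> bool" where
  "holder_in_space M p \<eta> U I \<longleftrightarrow>
     (\<exists>C\<ge>0. \<forall>t x x'. (t, x) \<in> U \<and> (t, x') \<in> U \<longrightarrow>
        Lp_norm M p (\<lambda>\<omega>. I t x \<omega> - I t x' \<omega>) \<le> ennreal (C * \<bar>x - x'\<bar> powr \<eta>))"

definition holder_in_time ::
    "'a measure \<Rightarrow> real \<Rightarrow> real \<Rightarrow> (real \<times> real) set \<Rightarrow> (real \<Rightarrow> real \<Rightarrow> 'a \<Rightarrow> real) \<Rightarrow> bool" where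
  "holder_in_time M p \<eta> U I \<longleftrightarrow>
     (\<exists>C\<ge>0. \<forall>t t' x. (t, x) \<in> U \<and> (t', x) \<in> U \<longrightarrow>
        Lp_norm M p (\<lambda>\<omega>. I t x \<omega> - I t' x \<omega>) \<le> ennreal (C * \<bar>t - t'\<bar> powr \<eta>))"

end

theory Submission
  imports Defs
begin

text \<open>The stochastic part \<open>I\<close> is rough near the characteristic \<open>\<bar>x\<bar> = \<kappa> t\<close> because the singularity of the
  initial datum travels along it. Take \<open>(t\<^sub>0, x\<^sub>0)\<close> on the line and a point at distance of order \<open>\<delta>\<close>
  outside of it. The backward cone of the first point contains a strip \<open>S\<close> of width \<open>\<delta>\<close> along the
  characteristic which the cone of the second point misses (\<open>wave_kernel_strip\<close>), and on \<open>S\<close> the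
  homogeneous solution is at least \<open>\<delta> powr (- a) / 2\<close> (\<open>wave_homogeneous_strip\<close>). Moving away in space or
  backwards in time makes no difference. For \<open>a = 0\<close> there is no singularity, and the sharp edge of the
  cone alone accounts for the exponent \<open>1/2\<close>.

  The textbook argument bounds the second moment of the increment of \<open>I\<close> from below by the Ito isometry.
  Here the increment is paired with the single Gaussian variable \<open>W S\<close> instead, and Cauchy--Schwarz
  is used. The integrand thus enters linearly, through the mean of \<open>\<rho> (u s y)\<close>. This mean could cancel
  for a general coefficient, but the growth identity forces \<open>\<epsilon> * \<rho> v \<ge> \<bar>lam\<bar> * v\<close> for one sign \<open>\<epsilon>\<close>
  and all \<open>v\<close> (\<open>sign_dominates_linear\<close>), and \<open>u s y\<close> has mean equal to the homogeneous solution
  (\<open>expectation_diffusion_ge\<close>). The pairing is therefore at least of order \<open>\<delta> powr (- a)\<close> times the area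
  of \<open>S\<close>. As \<open>W S\<close> has variance equal to this area, which is of order \<open>\<delta>\<close>, the second moment of the
  increment is at least of order \<open>\<delta> powr (1 - 2 * a)\<close> (\<open>increment_lower_bound\<close>). Since
  \<open>p \<ge> 2\<close>, a Hoelder bound with exponent \<open>\<eta>\<close> would bound it by a multiple of \<open>\<delta> powr (2 * \<eta>)\<close>,
  which is impossible for \<open>2 * \<eta> > 1 - 2 * a\<close> as \<open>\<delta>\<close> tends to zero.

  The probabilistic input is that the covariance of a Walsh integral with \<open>W S\<close> is the integral over
  \<open>S\<close> of the mean of the integrand (\<open>walsh_integral_pairing\<close>). For elementary processes it rests on
  the independence of future noise from the past. The white noise is given only as a Gaussian process
  with prescribed covariance, so this independence is derived from the fact that uncorrelated jointly
  Gaussian variables are independent (\<open>gaussian_uncorrelated_indep\<close>), which is reduced to the uniqueness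
  theorem for characteristic functions on the line.\<close>

section \<open>Square-integrable functions\<close>

definition square_integrable :: "'a measure \<Rightarrow> ('a \<Rightarrow> real) \<Rightarrow> bool" where
  "square_integrable M f \<longleftrightarrow> f \<in> borel_measurable M \<and> integrable M (\<lambda>x. (f x)\<^sup>2)"

lemma square_integrable_mult:
  assumes "square_integrable M f" "square_integrable M g"
  shows "integrable M (\<lambda>x. f x * g x)"
proof (rule Bochner_Integration.integrable_bound)
  show "integrable M (\<lambda>x. (f x)\<^sup>2 + (g x)\<^sup>2)"
    using assms by (simp add: square_integrable_def)
  show "(\<lambda>x. f x * g x) \<in> borel_measurable M"
    using assms by (auto simp: square_integrable_def)
  have "\<bar>a * b\<bar> \<le> a\<^sup>2 + b\<^sup>2" for a b :: real
  proof -
    have "0 \<le> (\<bar>a\<bar> - \<bar>b\<bar>)\<^sup>2" by simp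
    also have "\<dots> = a\<^sup>2 + b\<^sup>2 - 2 * \<bar>a * b\<bar>" by (simp add: power2_diff abs_mult)
    finally show ?thesis using abs_ge_zero[of "a * b"] by linarith
  qed
  then show "AE x in M. norm (f x * g x) \<le> norm ((f x)\<^sup>2 + (g x)\<^sup>2)"
    by (intro AE_I2) (simp del: abs_mult add: abs_of_nonneg)
qed

lemma square_integrable_add:
  assumes "square_integrable M f" "square_integrable M g"
  shows "square_integrable M (\<lambda>x. f x + g x)"
proof -
  have "integrable M (\<lambda>x. (f x)\<^sup>2 + (g x)\<^sup>2 + 2 * (f x * g x))"
    using assms square_integrable_mult[OF assms] by (simp add: square_integrable_def)
  then show ?thesis
    using assms by (auto simp: square_integrable_def power2_sum algebra_simps)
qed

lemma square_integrable_cmult: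
  "square_integrable M f \<Longrightarrow> square_integrable M (\<lambda>x. c * f x)"
  by (auto simp: square_integrable_def power_mult_distrib)

lemma square_integrable_diff:
  assumes "square_integrable M f" "square_integrable M g"
  shows "square_integrable M (\<lambda>x. f x - g x)"
  using square_integrable_add[OF assms(1) square_integrable_cmult[OF assms(2), of "-1"]] by simp

lemma square_integrable_bounded_mult:
  assumes f: "square_integrable M f" and X: "X \<in> borel_measurable M"
    and c: "\<And>x. x \<in> space M \<Longrightarrow> \<bar>X x\<bar> \<le> c"
  shows "square_integrable M (\<lambda>x. X x * f x)"
  unfolding square_integrable_def
proof
  show m: "(\<lambda>x. X x * f x) \<in> borel_measurable M"
    using f X by (auto simp: square_integrable_def)
  show "integrable M (\<lambda>x. (X x * f x)\<^sup>2)"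
  proof (rule Bochner_Integration.integrable_bound)
    show "integrable M (\<lambda>x. c\<^sup>2 * (f x)\<^sup>2)" using f by (simp add: square_integrable_def)
    show "(\<lambda>x. (X x * f x)\<^sup>2) \<in> borel_measurable M" using m by simp
    show "AE x in M. norm ((X x * f x)\<^sup>2) \<le> norm (c\<^sup>2 * (f x)\<^sup>2)"
    proof (rule AE_I2)
      fix x assume "x \<in> space M"
      from c[OF this] have "(X x)\<^sup>2 \<le> c\<^sup>2" by (rule abs_le_square_iff[THEN iffD1, OF order_trans]) simp
      then show "norm ((X x * f x)\<^sup>2) \<le> norm (c\<^sup>2 * (f x)\<^sup>2)"
        by (simp add: power_mult_distrib mult_right_mono abs_of_nonneg)
    qed
  qed
qed

lemma (in finite_measure) square_integrable_integrable:
  "square_integrable M f \<Longrightarrow> integrable M f"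
  unfolding square_integrable_def by (auto intro: square_integrable_imp_integrable)

lemma (in finite_measure) square_integrable_const: "square_integrable M (\<lambda>x. c)"
  by (simp add: square_integrable_def)

lemma integral_Cauchy_Schwarz:
  assumes f: "square_integrable M f" and g: "square_integrable M g"
  shows "(\<integral>x. f x * g x \<partial>M)\<^sup>2 \<le> (\<integral>x. (f x)\<^sup>2 \<partial>M) * (\<integral>x. (g x)\<^sup>2 \<partial>M)"
proof -
  define A B C where "A = (\<integral>x. (f x)\<^sup>2 \<partial>M)" and "B = (\<integral>x. f x * g x \<partial>M)"
    and "C = (\<integral>x. (g x)\<^sup>2 \<partial>M)"
  have i: "integrable M (\<lambda>x. (f x)\<^sup>2)" "integrable M (\<lambda>x. f x * g x)" "integrable M (\<lambda>x. (g x)\<^sup>2)"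
    using f g square_integrable_mult by (auto simp: square_integrable_def)
  have C0: "C \<ge> 0" unfolding C_def by simp
  show ?thesis
  proof (cases "C = 0")
    case True
    then have "AE x in M. (g x)\<^sup>2 = 0"
      unfolding C_def using i(3) by (subst (asm) integral_nonneg_eq_0_iff_AE) auto
    then have "AE x in M. f x * g x = 0" by eventually_elim simp
    then have "B = 0" unfolding B_def by (rule integral_eq_zero_AE)
    with True show ?thesis unfolding A_def B_def C_def by simp
  next
    case False
    have "0 \<le> (\<integral>x. (C * f x - B * g x)\<^sup>2 \<partial>M)" by simp
    also have "(\<lambda>x. (C * f x - B * g x)\<^sup>2) = (\<lambda>x. C\<^sup>2 * (f x)\<^sup>2 - 2 * B * C * (f x * g x) + B\<^sup>2 * (g x)\<^sup>2)"
      by (simp add: fun_eq_iff power2_eq_square algebra_simps)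
    also have "(\<integral>x. C\<^sup>2 * (f x)\<^sup>2 - 2 * B * C * (f x * g x) + B\<^sup>2 * (g x)\<^sup>2 \<partial>M)
        = C\<^sup>2 * A - 2 * B * C * B + B\<^sup>2 * C"
      using i by (simp add: A_def B_def C_def)
    also have "\<dots> = C * (A * C - B\<^sup>2)" by (simp add: power2_eq_square algebra_simps)
    finally have "0 \<le> A * C - B\<^sup>2" using False C0 by (simp add: zero_le_mult_iff)
    then show ?thesis unfolding A_def B_def C_def by simp
  qed
qed

lemma nn_integral_square_eq:
  "square_integrable M f \<Longrightarrow> (\<integral>\<^sup>+x. ennreal ((f x)\<^sup>2) \<partial>M) = ennreal (\<integral>x. (f x)\<^sup>2 \<partial>M)"
  unfolding square_integrable_def by (intro nn_integral_eq_integral) auto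

lemma square_integrableI_nn:
  assumes "f \<in> borel_measurable M" "(\<integral>\<^sup>+x. ennreal ((f x)\<^sup>2) \<partial>M) < \<infinity>"
  shows "square_integrable M f"
  using assms unfolding square_integrable_def by (auto intro: integrableI_nonneg)

text \<open>The only passage to the limit in the construction of the Walsh integral: pairing with a fixed
  square-integrable \<open>z\<close> is continuous along mean-square convergence. The convergence is phrased with
  \<open>nn_integral\<close>, so that square-integrability of the limit is a conclusion: finitely many terms aside,
  the distance to the approximants is finite.\<close>
lemma L2_limit:
  assumes f: "f \<in> borel_measurable M" and h: "\<And>n. square_integrable M (h n)"
    and lim: "(\<lambda>n. \<integral>\<^sup>+x. ennreal ((f x - h n x)\<^sup>2) \<partial>M) \<longlonglongrightarrow> 0"
  shows L2_limit_square_integrable: "square_integrable M f"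
    and L2_limit_pairing: "square_integrable M z \<Longrightarrow>
      (\<lambda>n. \<integral>x. h n x * z x \<partial>M) \<longlonglongrightarrow> (\<integral>x. f x * z x \<partial>M)"
proof -
  have "\<forall>\<^sub>F n in sequentially. (\<integral>\<^sup>+x. ennreal ((f x - h n x)\<^sup>2) \<partial>M) < 1"
    using lim by (rule order_tendstoD) simp
  then obtain n0 where n0: "(\<integral>\<^sup>+x. ennreal ((f x - h n0 x)\<^sup>2) \<partial>M) < 1"
    by (auto simp: eventually_sequentially)
  have "square_integrable M (\<lambda>x. f x - h n0 x)"
    using f h[of n0] n0 by (intro square_integrableI_nn) (auto simp: square_integrable_def intro: less_trans)
  from square_integrable_add[OF this h[of n0]] show L2: "square_integrable M f" by simp
  then have d: "square_integrable M (\<lambda>x. f x - h n x)" for n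
    using h by (rule square_integrable_diff)
  have "(\<lambda>n. ennreal (\<integral>x. (f x - h n x)\<^sup>2 \<partial>M)) \<longlonglongrightarrow> ennreal 0"
    using lim by (simp add: nn_integral_square_eq[OF d])
  then have l0: "(\<lambda>n. \<integral>x. (f x - h n x)\<^sup>2 \<partial>M) \<longlonglongrightarrow> 0"
    by (subst (asm) tendsto_ennreal_iff) auto
  assume z: "square_integrable M z"
  have "(\<lambda>n. (\<integral>x. (f x - h n x) * z x \<partial>M)\<^sup>2) \<longlonglongrightarrow> 0"
  proof (rule tendsto_sandwich[OF _ _ tendsto_const])
    show "(\<lambda>n. (\<integral>x. (f x - h n x)\<^sup>2 \<partial>M) * (\<integral>x. (z x)\<^sup>2 \<partial>M)) \<longlonglongrightarrow> 0"
      using tendsto_mult_right[OF l0] by simp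
    show "\<forall>\<^sub>F n in sequentially. (\<integral>x. (f x - h n x) * z x \<partial>M)\<^sup>2
        \<le> (\<integral>x. (f x - h n x)\<^sup>2 \<partial>M) * (\<integral>x. (z x)\<^sup>2 \<partial>M)"
      using integral_Cauchy_Schwarz[OF d z] by simp
  qed auto
  then have "(\<lambda>n. \<integral>x. (f x - h n x) * z x \<partial>M) \<longlonglongrightarrow> 0" by simp
  moreover have "(\<integral>x. (f x - h n x) * z x \<partial>M) = (\<integral>x. f x * z x \<partial>M) - (\<integral>x. h n x * z x \<partial>M)" for n
    using square_integrable_mult[OF L2 z] square_integrable_mult[OF h z]
    by (simp add: left_diff_distrib)
  ultimately have "(\<lambda>n. (\<integral>x. f x * z x \<partial>M) - (\<integral>x. h n x * z x \<partial>M)) \<longlonglongrightarrow> 0" by simp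
  from tendsto_diff[OF tendsto_const[of "\<integral>x. f x * z x \<partial>M"] this]
  show "(\<lambda>n. \<integral>x. h n x * z x \<partial>M) \<longlonglongrightarrow> (\<integral>x. f x * z x \<partial>M)" by simp
qed

section \<open>Gaussian variables and independence\<close>

lemma (in prob_space) centered_gaussian_facts:
  assumes "centered_gaussian M X"
  shows centered_gaussian_measurable: "X \<in> borel_measurable M"
    and centered_gaussian_square_integrable: "square_integrable M X"
    and centered_gaussian_mean: "expectation X = 0"
    and centered_gaussian_sin: "expectation (\<lambda>\<omega>. sin (X \<omega>)) = 0"
    and centered_gaussian_cos: "expectation (\<lambda>\<omega>. cos (X \<omega>)) = exp (- expectation (\<lambda>\<omega>. (X \<omega>)\<^sup>2) / 2)"
proof -
  let ?N = std_normal_distribution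
  obtain s where X: "X \<in> borel_measurable M" and s: "distr M borel X = distr ?N borel (\<lambda>z. s * z)"
    using assms unfolding centered_gaussian_def by blast
  interpret N: real_distribution ?N by (rule real_dist_normal_dist)
  have s_meas: "(\<lambda>z. s * z) \<in> borel_measurable ?N" by simp
  have E: "expectation (\<lambda>\<omega>. h (X \<omega>)) = (\<integral>z. h (s * z) \<partial>?N)"
    if "h \<in> borel_measurable borel" for h :: "real \<Rightarrow> real"
    using integral_distr[OF X that] integral_distr[OF s_meas that] s by simp
  have Ii: "integrable M (\<lambda>\<omega>. h (X \<omega>)) \<longleftrightarrow> integrable ?N (\<lambda>z. h (s * z))"
    if "h \<in> borel_measurable borel" for h :: "real \<Rightarrow> real"
    using integrable_distr_eq[OF X that] integrable_distr_eq[OF s_meas that] s by simp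
  show "X \<in> borel_measurable M" by (rule X)
  have "integrable ?N (\<lambda>z. (s * z)\<^sup>2)"
    using integrable_std_normal_distribution_moment[of 2] by (simp add: power_mult_distrib)
  then show "square_integrable M X"
    unfolding square_integrable_def using X Ii[of "\<lambda>x. x\<^sup>2"] by simp
  show "expectation X = 0"
    using E[of "\<lambda>x. x"] integral_std_normal_distribution_moment_odd[of 1] by simp
  have v: "expectation (\<lambda>\<omega>. (X \<omega>)\<^sup>2) = s\<^sup>2"
    using E[of "\<lambda>x. x\<^sup>2"] std_normal_distribution_even_moments(1)[of 1]
    by (simp add: power_mult_distrib)
  have ch: "(CLINT z|?N. iexp (s * z)) = complex_of_real (exp (- (s\<^sup>2) / 2))"
    using char_std_normal_distribution unfolding char_def by (rule fun_cong)
  have ci: "complex_integrable ?N (\<lambda>z. iexp (s * z))"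
    by (rule N.integrable_const_bound[where B=1]) auto
  have "(\<integral>z. cos (s * z) \<partial>?N) = Re (CLINT z|?N. iexp (s * z))"
    using integral_Re[OF ci] by (simp add: Re_exp)
  then show "expectation (\<lambda>\<omega>. cos (X \<omega>)) = exp (- expectation (\<lambda>\<omega>. (X \<omega>)\<^sup>2) / 2)"
    using E[of cos] ch v by simp
  have "(\<integral>z. sin (s * z) \<partial>?N) = Im (CLINT z|?N. iexp (s * z))"
    using integral_Im[OF ci] by (simp add: Im_exp)
  then show "expectation (\<lambda>\<omega>. sin (X \<omega>)) = 0"
    using E[of sin] ch by simp
qed

text \<open>The signed measure \<open>B \<mapsto> E[X 1\<^sub>B(Z)]\<close> has vanishing Fourier transform, hence is zero. Levy's theorem
  speaks about probability measures only; it is applied to the laws of \<open>Z\<close> under the original measure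
  and under the measure with density \<open>1 + X / L\<close>. The density is nonnegative once \<open>L\<close> bounds \<open>\<bar>X\<bar>\<close>, and
  it has total mass one because frequency zero gives \<open>E[X] = 0\<close>.\<close>
lemma (in prob_space) fourier_zero_imp_integral_indicator_zero:
  fixes X Z :: "'a \<Rightarrow> real"
  assumes X: "X \<in> borel_measurable M" and bdd: "\<And>\<omega>. \<omega> \<in> space M \<Longrightarrow> \<bar>X \<omega>\<bar> \<le> K"
    and Z: "Z \<in> borel_measurable M"
    and c: "\<And>c. expectation (\<lambda>\<omega>. X \<omega> * cos (c * Z \<omega>)) = 0"
    and s: "\<And>c. expectation (\<lambda>\<omega>. X \<omega> * sin (c * Z \<omega>)) = 0"
    and B: "B \<in> sets borel"
  shows "expectation (\<lambda>\<omega>. X \<omega> * indicator B (Z \<omega>)) = 0"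
proof -
  define L where "L = max K 1"
  have L: "L > 0" by (simp add: L_def less_max_iff_disj)
  have XL: "\<bar>X \<omega>\<bar> \<le> L" if "\<omega> \<in> space M" for \<omega>
    using bdd[OF that] by (simp add: L_def)
  \<comment> \<open>The maximum keeps the density nonnegative outside the sample space as well.\<close>
  define D where "D = (\<lambda>\<omega>. max 0 (1 + X \<omega> / L))"
  have D: "D \<omega> = 1 + X \<omega> / L" if "\<omega> \<in> space M" for \<omega>
    using XL[OF that] L by (auto simp: D_def field_simps abs_le_iff)
  have Dm[measurable]: "D \<in> borel_measurable M" using X unfolding D_def by simp
  note X[measurable] Z[measurable]
  have D0: "AE \<omega> in M. 0 \<le> D \<omega>" by (simp add: D_def)
  have Xi: "integrable M X"
    using X bdd by (intro integrable_const_bound[where B=K]) auto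
  have EX: "expectation X = 0" using c[of 0] by simp
  let ?Q = "density M (\<lambda>\<omega>. ennreal (D \<omega>))"
  have IQ: "(\<integral>\<omega>. h (Z \<omega>) \<partial>?Q) = expectation (\<lambda>\<omega>. h (Z \<omega>)) + expectation (\<lambda>\<omega>. X \<omega> * h (Z \<omega>)) / L"
    if [measurable]: "h \<in> borel_measurable borel" and hb: "\<And>z. \<bar>h z\<bar> \<le> 1" for h :: "real \<Rightarrow> real"
  proof -
    have i1: "integrable M (\<lambda>\<omega>. h (Z \<omega>))"
      using hb by (intro integrable_const_bound[where B=1]) auto
    have i2: "integrable M (\<lambda>\<omega>. X \<omega> * h (Z \<omega>))"
    proof (intro integrable_const_bound[where B=L] AE_I2)
      show "norm (X \<omega> * h (Z \<omega>)) \<le> L" if "\<omega> \<in> space M" for \<omega>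
        using mult_mono[OF XL[OF that] hb[of "Z \<omega>"]] L by (simp add: abs_mult)
    qed simp
    have "(\<integral>\<omega>. h (Z \<omega>) \<partial>?Q) = expectation (\<lambda>\<omega>. D \<omega> * h (Z \<omega>))"
      using D0 by (subst integral_density) auto
    also have "\<dots> = expectation (\<lambda>\<omega>. h (Z \<omega>) + X \<omega> * h (Z \<omega>) / L)"
      by (intro Bochner_Integration.integral_cong) (auto simp: D algebra_simps)
    also have "\<dots> = expectation (\<lambda>\<omega>. h (Z \<omega>)) + expectation (\<lambda>\<omega>. X \<omega> * h (Z \<omega>)) / L"
      using i1 i2 by simp
    finally show ?thesis .
  qed
  have Qp: "prob_space ?Q"
  proof (rule prob_spaceI)
    have "emeasure ?Q (space ?Q) = (\<integral>\<^sup>+\<omega>. ennreal (D \<omega>) \<partial>M)"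
      by (simp add: emeasure_density nn_integral_set_ennreal)
    also have "\<dots> = (\<integral>\<^sup>+\<omega>. ennreal (1 + X \<omega> / L) \<partial>M)"
      by (intro nn_integral_cong) (simp add: D)
    also have "\<dots> = ennreal (expectation (\<lambda>\<omega>. 1 + X \<omega> / L))"
    proof (intro nn_integral_eq_integral AE_I2)
      show "0 \<le> 1 + X \<omega> / L" if "\<omega> \<in> space M" for \<omega>
        using D[OF that] by (simp add: D_def max_def split: if_splits)
    qed (use Xi in simp)
    also have "expectation (\<lambda>\<omega>. 1 + X \<omega> / L) = 1"
      using Xi EX by (simp add: prob_space)
    finally show "emeasure ?Q (space ?Q) = 1" by simp
  qed
  then interpret Q: prob_space ?Q .
  have ZQ: "Z \<in> borel_measurable ?Q" by simp
  have "distr ?Q borel Z = distr M borel Z"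
  proof (rule Levy_uniqueness)
    show "real_distribution (distr ?Q borel Z)" using ZQ by (rule Q.real_distribution_distr)
    show "real_distribution (distr M borel Z)" by simp
    show "char (distr ?Q borel Z) = char (distr M borel Z)"
    proof
      fix t
      have ci: "complex_integrable ?Q (\<lambda>\<omega>. iexp (t * Z \<omega>))"
        by (rule Q.integrable_const_bound[where B=1]) auto
      have ci': "complex_integrable M (\<lambda>\<omega>. iexp (t * Z \<omega>))"
        by (rule integrable_const_bound[where B=1]) auto
      have "(CLINT \<omega>|?Q. iexp (t * Z \<omega>)) = (CLINT \<omega>|M. iexp (t * Z \<omega>))"
      proof (rule complex_eqI)
        show "Re (CLINT \<omega>|?Q. iexp (t * Z \<omega>)) = Re (CLINT \<omega>|M. iexp (t * Z \<omega>))"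
          using integral_Re[OF ci] integral_Re[OF ci'] IQ[of "\<lambda>z. cos (t * z)"] c[of t] by (simp add: Re_exp)
        show "Im (CLINT \<omega>|?Q. iexp (t * Z \<omega>)) = Im (CLINT \<omega>|M. iexp (t * Z \<omega>))"
          using integral_Im[OF ci] integral_Im[OF ci'] IQ[of "\<lambda>z. sin (t * z)"] s[of t] by (simp add: Im_exp)
      qed
      then show "char (distr ?Q borel Z) t = char (distr M borel Z) t"
        unfolding char_def by (simp add: integral_distr)
    qed
  qed
  then have D_eq: "(\<integral>x. indicator B x \<partial>distr ?Q borel Z) = (\<integral>x. indicator B x \<partial>distr M borel Z :: real)"
    by simp
  have "(\<integral>\<omega>. indicator B (Z \<omega>) \<partial>?Q) = (\<integral>x. indicator B x \<partial>distr ?Q borel Z :: real)"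
    by (rule integral_distr[symmetric]) (use B in auto)
  also note D_eq
  also have "(\<integral>x. indicator B x \<partial>distr M borel Z :: real) = expectation (\<lambda>\<omega>. indicator B (Z \<omega>))"
    by (rule integral_distr) (use B in auto)
  finally have "(\<integral>\<omega>. indicator B (Z \<omega>) \<partial>?Q) = expectation (\<lambda>\<omega>. indicator B (Z \<omega>) :: real)" .
  with IQ[of "indicator B"] B L show ?thesis by (auto simp: indicator_def split: if_splits)
qed

lemma (in prob_space) bounded_mult_integrable:
  assumes "X \<in> borel_measurable M" "\<And>\<omega>. \<omega> \<in> space M \<Longrightarrow> \<bar>X \<omega>\<bar> \<le> K"
    and "h \<in> borel_measurable M" "\<And>\<omega>. \<bar>h \<omega>\<bar> \<le> 1"
  shows "integrable M (\<lambda>\<omega>. X \<omega> * h \<omega> :: real)"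
proof (rule integrable_const_bound[where B="\<bar>K\<bar>"])
  show "(\<lambda>\<omega>. X \<omega> * h \<omega>) \<in> borel_measurable M" using assms by auto
  show "AE \<omega> in M. norm (X \<omega> * h \<omega>) \<le> \<bar>K\<bar>"
  proof (rule AE_I2)
    fix \<omega> assume "\<omega> \<in> space M"
    from mult_mono[OF assms(2)[OF this] assms(4)[of \<omega>]] assms(2)[OF this]
    show "norm (X \<omega> * h \<omega>) \<le> \<bar>K\<bar>" by (simp add: abs_mult)
  qed
qed

text \<open>The same uniqueness principle in several variables. It is obtained one coordinate at a time: the
  trigonometric weight of the remaining coordinates is absorbed into the bounded factor \<open>X\<close>, and the
  one-dimensional statement turns the frequency of the current coordinate into an indicator.\<close>
lemma (in prob_space) fourier_zero_imp_integral_prod_indicator_zero: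
  fixes X :: "'a \<Rightarrow> real" and Z :: "'j \<Rightarrow> 'a \<Rightarrow> real"
  assumes "finite S"
    and "X \<in> borel_measurable M" "\<And>\<omega>. \<omega> \<in> space M \<Longrightarrow> \<bar>X \<omega>\<bar> \<le> K"
    and "\<And>j. j \<in> S \<Longrightarrow> Z j \<in> borel_measurable M" "\<And>j. j \<in> S \<Longrightarrow> B j \<in> sets borel"
    and "\<And>c. expectation (\<lambda>\<omega>. X \<omega> * cos (\<Sum>j\<in>S. c j * Z j \<omega>)) = 0"
    and "\<And>c. expectation (\<lambda>\<omega>. X \<omega> * sin (\<Sum>j\<in>S. c j * Z j \<omega>)) = 0"
  shows "expectation (\<lambda>\<omega>. X \<omega> * (\<Prod>j\<in>S. indicator (B j) (Z j \<omega>))) = 0"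
  using assms
proof (induction S arbitrary: X rule: finite_induct)
  case empty
  from empty.prems(5)[of "\<lambda>_. 0"] show ?case by simp
next
  case (insert k S)
  note [measurable] = insert.prems(1)
  have [measurable]: "Z k \<in> borel_measurable M" "B k \<in> sets borel"
    using insert.prems(3,4) by auto
  have Zm: "Z j \<in> borel_measurable M" if "j \<in> S" for j using insert.prems(3) that by auto
  let ?N = "\<lambda>c \<omega>. \<Sum>j\<in>S. c j * Z j \<omega>"
  have Nm[measurable]: "?N c \<in> borel_measurable M" for c
    using Zm by (intro borel_measurable_sum) auto
  have N: "(\<Sum>j\<in>insert k S. (c(k := d)) j * Z j \<omega>) = ?N c \<omega> + d * Z k \<omega>" for c d \<omega>
  proof -
    have "(\<Sum>j\<in>S. (c(k := d)) j * Z j \<omega>) = ?N c \<omega>"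
      using insert.hyps by (intro sum.cong) auto
    then show ?thesis using insert.hyps by simp
  qed
  have Ec: "expectation (\<lambda>\<omega>. X \<omega> * cos (?N c \<omega> + d * Z k \<omega>)) = 0"
    and Es: "expectation (\<lambda>\<omega>. X \<omega> * sin (?N c \<omega> + d * Z k \<omega>)) = 0" for c d
    using insert.prems(5)[of "c(k := d)"] insert.prems(6)[of "c(k := d)"] unfolding N by auto
  have ic: "integrable M (\<lambda>\<omega>. X \<omega> * cos (?N c \<omega> + d * Z k \<omega>))"
    and isn: "integrable M (\<lambda>\<omega>. X \<omega> * sin (?N c \<omega> + d * Z k \<omega>))" for c d
    by (rule bounded_mult_integrable[OF _ insert.prems(2)]; simp)+
  \<comment> \<open>The hypothesis at the frequencies \<open>d\<close> and \<open>-d\<close> of the new coordinate separates the products.\<close>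
  have cc: "expectation (\<lambda>\<omega>. X \<omega> * cos (?N c \<omega>) * cos (d * Z k \<omega>)) = 0" for c d
  proof -
    have "(\<lambda>\<omega>. X \<omega> * cos (?N c \<omega>) * cos (d * Z k \<omega>)) =
       (\<lambda>\<omega>. (X \<omega> * cos (?N c \<omega> + d * Z k \<omega>) + X \<omega> * cos (?N c \<omega> + (-d) * Z k \<omega>)) / 2)"
      by (simp add: cos_add cos_diff fun_eq_iff algebra_simps)
    then show ?thesis by (simp only:) (simp add: ic Ec ic[of c "- d", simplified] Ec[of c "- d", simplified])
  qed
  have cs: "expectation (\<lambda>\<omega>. X \<omega> * cos (?N c \<omega>) * sin (d * Z k \<omega>)) = 0" for c d
  proof -
    have "(\<lambda>\<omega>. X \<omega> * cos (?N c \<omega>) * sin (d * Z k \<omega>)) =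
       (\<lambda>\<omega>. (X \<omega> * sin (?N c \<omega> + d * Z k \<omega>) - X \<omega> * sin (?N c \<omega> + (-d) * Z k \<omega>)) / 2)"
      by (simp add: sin_add sin_diff fun_eq_iff algebra_simps)
    then show ?thesis by (simp only:) (simp add: isn Es isn[of c "- d", simplified] Es[of c "- d", simplified])
  qed
  have sc: "expectation (\<lambda>\<omega>. X \<omega> * sin (?N c \<omega>) * cos (d * Z k \<omega>)) = 0" for c d
  proof -
    have "(\<lambda>\<omega>. X \<omega> * sin (?N c \<omega>) * cos (d * Z k \<omega>)) =
       (\<lambda>\<omega>. (X \<omega> * sin (?N c \<omega> + d * Z k \<omega>) + X \<omega> * sin (?N c \<omega> + (-d) * Z k \<omega>)) / 2)"
      by (simp add: sin_add sin_diff fun_eq_iff algebra_simps)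
    then show ?thesis by (simp only:) (simp add: isn Es isn[of c "- d", simplified] Es[of c "- d", simplified])
  qed
  have ss: "expectation (\<lambda>\<omega>. X \<omega> * sin (?N c \<omega>) * sin (d * Z k \<omega>)) = 0" for c d
  proof -
    have "(\<lambda>\<omega>. X \<omega> * sin (?N c \<omega>) * sin (d * Z k \<omega>)) =
       (\<lambda>\<omega>. (X \<omega> * cos (?N c \<omega> + (-d) * Z k \<omega>) - X \<omega> * cos (?N c \<omega> + d * Z k \<omega>)) / 2)"
      by (simp add: cos_add cos_diff fun_eq_iff algebra_simps)
    then show ?thesis by (simp only:) (simp add: ic Ec ic[of c "- d", simplified] Ec[of c "- d", simplified])
  qed
  have K0: "\<bar>X \<omega> * h\<bar> \<le> \<bar>K\<bar>" if "\<omega> \<in> space M" "\<bar>h\<bar> \<le> 1" for \<omega> h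
    using mult_mono[OF insert.prems(2)[OF that(1)] that(2)] insert.prems(2)[OF that(1)]
    by (simp add: abs_mult)
  let ?X = "\<lambda>\<omega>. X \<omega> * indicator (B k) (Z k \<omega>)"
  have "expectation (\<lambda>\<omega>. ?X \<omega> * (\<Prod>j\<in>S. indicator (B j) (Z j \<omega>))) = 0"
  proof (rule insert.IH)
    show "?X \<in> borel_measurable M" by measurable
    show "\<bar>?X \<omega>\<bar> \<le> K" if "\<omega> \<in> space M" for \<omega>
      using insert.prems(2)[OF that] abs_ge_zero[of "X \<omega>"] by (auto simp: indicator_def)
    show "Z j \<in> borel_measurable M" if "j \<in> S" for j using that by (rule Zm)
    show "B j \<in> sets borel" if "j \<in> S" for j using insert.prems(4) that by simp
    have "expectation (\<lambda>\<omega>. X \<omega> * cos (?N c \<omega>) * indicator (B k) (Z k \<omega>)) = 0" for c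
      using cc cs K0 by (intro fourier_zero_imp_integral_indicator_zero[where K="\<bar>K\<bar>"]) auto
    then show "expectation (\<lambda>\<omega>. ?X \<omega> * cos (?N c \<omega>)) = 0" for c
      by (simp add: ac_simps)
    have "expectation (\<lambda>\<omega>. X \<omega> * sin (?N c \<omega>) * indicator (B k) (Z k \<omega>)) = 0" for c
      using sc ss K0 by (intro fourier_zero_imp_integral_indicator_zero[where K="\<bar>K\<bar>"]) auto
    then show "expectation (\<lambda>\<omega>. ?X \<omega> * sin (?N c \<omega>)) = 0" for c
      by (simp add: ac_simps)
  qed
  then show ?case using insert.hyps by (simp add: mult.assoc)
qed

text \<open>For uncorrelated jointly Gaussian \<open>V\<close> and \<open>N\<close> the variance of \<open>\<theta> V + N\<close> is additive, so its
  characteristic function is a product. Fourier uniqueness in the variable \<open>V\<close> then replaces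
  \<open>exp (\<i> \<theta> V)\<close> by the indicator of a Borel set.\<close>
lemma (in prob_space) gaussian_uncorrelated_trig:
  assumes gauss: "\<And>\<theta> d. centered_gaussian M (\<lambda>\<omega>. \<theta> * V \<omega> + d * N \<omega>)"
    and uncorr: "expectation (\<lambda>\<omega>. V \<omega> * N \<omega>) = 0"
    and B: "B \<in> sets borel"
  shows "expectation (\<lambda>\<omega>. (indicator B (V \<omega>) - prob (V -` B \<inter> space M)) * cos (N \<omega>)) = 0"
    and "expectation (\<lambda>\<omega>. (indicator B (V \<omega>) - prob (V -` B \<inter> space M)) * sin (N \<omega>)) = 0"
proof -
  have V: "centered_gaussian M V" and N: "centered_gaussian M N"
    using gauss[of 1 0] gauss[of 0 1] by simp_all
  note [measurable] = centered_gaussian_measurable[OF V] centered_gaussian_measurable[OF N]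
  note L2 = centered_gaussian_square_integrable[OF V] centered_gaussian_square_integrable[OF N]
  define v n where "v = expectation (\<lambda>\<omega>. (V \<omega>)\<^sup>2)" and "n = expectation (\<lambda>\<omega>. (N \<omega>)\<^sup>2)"
  have var: "expectation (\<lambda>\<omega>. (\<theta> * V \<omega> + d * N \<omega>)\<^sup>2) = \<theta>\<^sup>2 * v + d\<^sup>2 * n" for \<theta> d
  proof -
    have "(\<lambda>\<omega>. (\<theta> * V \<omega> + d * N \<omega>)\<^sup>2)
      = (\<lambda>\<omega>. \<theta>\<^sup>2 * (V \<omega>)\<^sup>2 + d\<^sup>2 * (N \<omega>)\<^sup>2 + (2 * \<theta> * d) * (V \<omega> * N \<omega>))"
      by (simp add: fun_eq_iff power2_eq_square algebra_simps)
    then show ?thesis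
      using L2 square_integrable_mult[OF L2] uncorr
      by (simp add: square_integrable_def v_def n_def)
  qed
  have ecos: "expectation (\<lambda>\<omega>. cos (\<theta> * V \<omega> + d * N \<omega>)) = exp (- \<theta>\<^sup>2 * v / 2) * exp (- d\<^sup>2 * n / 2)" for \<theta> d
    using centered_gaussian_cos[OF gauss[of \<theta> d]] by (simp add: var exp_add[symmetric] field_simps)
  have esin: "expectation (\<lambda>\<omega>. sin (\<theta> * V \<omega> + d * N \<omega>)) = 0" for \<theta> d
    by (rule centered_gaussian_sin[OF gauss])
  have ic: "integrable M (\<lambda>\<omega>. cos (\<theta> * V \<omega> + d * N \<omega>))"
    and isn: "integrable M (\<lambda>\<omega>. sin (\<theta> * V \<omega> + d * N \<omega>))" for \<theta> d
    by (auto intro!: integrable_const_bound[where B=1])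
  define m where "m = exp (- n / 2)"
  have m: "expectation (\<lambda>\<omega>. cos (N \<omega>)) = m" "expectation (\<lambda>\<omega>. sin (N \<omega>)) = 0"
    using ecos[of 0 1] esin[of 0 1] by (simp_all add: m_def)
  have m1: "\<bar>m\<bar> \<le> 1" by (simp add: m_def n_def)
  have iV: "integrable M (\<lambda>\<omega>. cos (\<theta> * V \<omega>))" "integrable M (\<lambda>\<omega>. sin (\<theta> * V \<omega>))" for \<theta>
    using ic[of \<theta> 0] isn[of \<theta> 0] by simp_all
  have eV: "expectation (\<lambda>\<omega>. cos (\<theta> * V \<omega>)) = exp (- \<theta>\<^sup>2 * v / 2)" "expectation (\<lambda>\<omega>. sin (\<theta> * V \<omega>)) = 0" for \<theta>
    using ecos[of \<theta> 0] esin[of \<theta> 0] by simp_all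
  note IC = ic[of _ 1, simplified] ic[of _ "-1", simplified]
  note ISN = isn[of _ 1, simplified] isn[of _ "-1", simplified]
  note EC = ecos[of _ 1, simplified] ecos[of _ "-1", simplified]
  note ES = esin[of _ 1, simplified] esin[of _ "-1", simplified]
  have "expectation (\<lambda>\<omega>. (cos (N \<omega>) - m) * indicator B (V \<omega>)) = 0"
  proof (rule fourier_zero_imp_integral_indicator_zero[where K=2])
    show "\<bar>cos (N \<omega>) - m\<bar> \<le> 2" for \<omega>
      using m1 abs_cos_le_one[of "N \<omega>"] by linarith
    show "expectation (\<lambda>\<omega>. (cos (N \<omega>) - m) * cos (c * V \<omega>)) = 0" for c
    proof -
      have "(\<lambda>\<omega>. (cos (N \<omega>) - m) * cos (c * V \<omega>)) =
        (\<lambda>\<omega>. (cos (c * V \<omega> + 1 * N \<omega>) + cos (c * V \<omega> + (-1) * N \<omega>)) / 2 - m * cos (c * V \<omega>))"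
        by (simp add: cos_add cos_diff fun_eq_iff algebra_simps)
      then show ?thesis
        by (simp only:) (simp add: iV eV m_def IC EC)
    qed
    show "expectation (\<lambda>\<omega>. (cos (N \<omega>) - m) * sin (c * V \<omega>)) = 0" for c
    proof -
      have "(\<lambda>\<omega>. (cos (N \<omega>) - m) * sin (c * V \<omega>)) =
        (\<lambda>\<omega>. (sin (c * V \<omega> + 1 * N \<omega>) + sin (c * V \<omega> + (-1) * N \<omega>)) / 2 - m * sin (c * V \<omega>))"
        by (simp add: sin_add sin_diff fun_eq_iff algebra_simps)
      then show ?thesis
        by (simp only:) (simp add: iV eV ISN ES)
    qed
  qed (use B in auto)
  moreover have "expectation (\<lambda>\<omega>. sin (N \<omega>) * indicator B (V \<omega>)) = 0"
  proof (rule fourier_zero_imp_integral_indicator_zero[where K=1])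
    show "expectation (\<lambda>\<omega>. sin (N \<omega>) * cos (c * V \<omega>)) = 0" for c
    proof -
      have "(\<lambda>\<omega>. sin (N \<omega>) * cos (c * V \<omega>)) =
        (\<lambda>\<omega>. (sin (c * V \<omega> + 1 * N \<omega>) - sin (c * V \<omega> + (-1) * N \<omega>)) / 2)"
        by (simp add: sin_add sin_diff fun_eq_iff algebra_simps)
      then show ?thesis
        by (simp only:) (simp add: ISN ES)
    qed
    show "expectation (\<lambda>\<omega>. sin (N \<omega>) * sin (c * V \<omega>)) = 0" for c
    proof -
      have "(\<lambda>\<omega>. sin (N \<omega>) * sin (c * V \<omega>)) =
        (\<lambda>\<omega>. (cos (c * V \<omega> + (-1) * N \<omega>) - cos (c * V \<omega> + 1 * N \<omega>)) / 2)"
        by (simp add: cos_add cos_diff fun_eq_iff algebra_simps)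
      then show ?thesis
        by (simp only:) (simp add: IC EC)
    qed
  qed (use B in auto)
  moreover have p: "expectation (\<lambda>\<omega>. indicator B (V \<omega>)) = prob (V -` B \<inter> space M)"
  proof -
    have "expectation (\<lambda>\<omega>. indicator B (V \<omega>)) = expectation (\<lambda>\<omega>. indicator (V -` B \<inter> space M) \<omega> :: real)"
      by (intro Bochner_Integration.integral_cong) (auto simp: indicator_def)
    then show ?thesis using B by simp
  qed
  have i: "integrable M (\<lambda>\<omega>. cos (N \<omega>))" "integrable M (\<lambda>\<omega>. sin (N \<omega>))"
    using ic[of 0 1] isn[of 0 1] by simp_all
  have iB: "integrable M (\<lambda>\<omega>. cos (N \<omega>) * indicator B (V \<omega>))"
    "integrable M (\<lambda>\<omega>. sin (N \<omega>) * indicator B (V \<omega>))" "integrable M (\<lambda>\<omega>. indicator B (V \<omega>) :: real)"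
    using B by (auto intro!: integrable_const_bound[where B=1] simp: indicator_def)
  ultimately show
    "expectation (\<lambda>\<omega>. (indicator B (V \<omega>) - prob (V -` B \<inter> space M)) * cos (N \<omega>)) = 0"
    "expectation (\<lambda>\<omega>. (indicator B (V \<omega>) - prob (V -` B \<inter> space M)) * sin (N \<omega>)) = 0"
    using i iB m p by (simp_all add: left_diff_distrib algebra_simps)
qed

text \<open>Independence from the whole \<sigma>-algebra generated by a Gaussian family. The sets of the \<pi>-system are
  almost surely cylinders; the Boolean \<open>b\<close> in their description makes room for the null sets, which
  belong to the augmented filtration.\<close>
lemma (in prob_space) gaussian_uncorrelated_indep:
  fixes V :: "'a \<Rightarrow> real" and Y :: "'j \<Rightarrow> 'a \<Rightarrow> real"
  assumes gauss: "\<And>S c \<theta>. finite S \<Longrightarrow> S \<subseteq> J \<Longrightarrow>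
      centered_gaussian M (\<lambda>\<omega>. \<theta> * V \<omega> + (\<Sum>j\<in>S. c j * Y j \<omega>))"
    and uncorr: "\<And>j. j \<in> J \<Longrightarrow> expectation (\<lambda>\<omega>. V \<omega> * Y j \<omega>) = 0"
    and X: "X \<in> borel_measurable
      (sigma (space M) ({Y j -` B \<inter> space M | j B. j \<in> J \<and> B \<in> sets borel} \<union> null_sets M))"
  shows "indep_var borel V borel X"
proof -
  define G where "G = {Y j -` B \<inter> space M | j B. j \<in> J \<and> B \<in> sets borel} \<union> null_sets M"
  have Vg: "centered_gaussian M V" using gauss[of "{}" 1] by simp
  have Yg: "centered_gaussian M (Y j)" if "j \<in> J" for j
    using gauss[of "{j}" 0 "\<lambda>_. 1"] that by simp
  note Vm[measurable] = centered_gaussian_measurable[OF Vg]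
  have Ym: "Y j \<in> borel_measurable M" if "j \<in> J" for j
    using centered_gaussian_measurable[OF Yg[OF that]] .
  define P where "P = {A \<in> events. \<exists>S B b. finite S \<and> S \<subseteq> J \<and> (\<forall>j\<in>S. B j \<in> sets borel) \<and>
      (AE \<omega> in M. \<omega> \<in> A \<longleftrightarrow> b \<and> (\<forall>j\<in>S. Y j \<omega> \<in> (B j :: real set)))}"
  define Q where "Q = {V -` B \<inter> space M | B. B \<in> sets borel}"
  have PE: "P \<subseteq> events" by (auto simp: P_def)
  have "indep_set Q P"
  proof (rule indep_setI)
    show "Q \<subseteq> events" by (auto simp: Q_def)
    show "P \<subseteq> events" by (rule PE)
    fix q p assume "q \<in> Q" "p \<in> P"
    then obtain D S B b where D: "D \<in> sets borel" "q = V -` D \<inter> space M"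
      and p: "p \<in> events" and S: "finite S" "S \<subseteq> J" and B: "\<And>j. j \<in> S \<Longrightarrow> B j \<in> sets borel"
      and ae: "AE \<omega> in M. \<omega> \<in> p \<longleftrightarrow> b \<and> (\<forall>j\<in>S. Y j \<omega> \<in> B j)"
      unfolding P_def Q_def by blast
    have q: "q \<in> events" using D by simp
    show "prob (q \<inter> p) = prob q * prob p"
    proof (cases b)
      case False
      have "AE \<omega> in M. \<omega> \<notin> p" using ae by eventually_elim (simp add: False)
      then have "prob p = 0" using p by (simp add: prob_eq_0)
      moreover have "prob (q \<inter> p) \<le> prob p" using p by (intro finite_measure_mono) auto
      ultimately show ?thesis by (simp add: measure_le_0_iff)
    next
      case True
      let ?N = "\<lambda>c \<omega>. \<Sum>j\<in>S. c j * Y j \<omega>"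
      have g2: "centered_gaussian M (\<lambda>\<omega>. \<theta> * V \<omega> + d * ?N c \<omega>)" for \<theta> d c
        using gauss[OF S, of \<theta> "\<lambda>j. d * c j"] by (simp add: sum_distrib_left mult.assoc)
      have u2: "expectation (\<lambda>\<omega>. V \<omega> * ?N c \<omega>) = 0" for c
      proof -
        have "integrable M (\<lambda>\<omega>. V \<omega> * Y j \<omega>)" if "j \<in> S" for j
          using square_integrable_mult[OF centered_gaussian_square_integrable[OF Vg]
            centered_gaussian_square_integrable[OF Yg]] that S by auto
        moreover have "(\<lambda>\<omega>. V \<omega> * ?N c \<omega>) = (\<lambda>\<omega>. \<Sum>j\<in>S. c j * (V \<omega> * Y j \<omega>))"
          by (simp add: sum_distrib_left ac_simps)
        ultimately show ?thesis
          using uncorr S by (simp add: Bochner_Integration.integral_sum subset_iff)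
      qed
      define X0 where "X0 = (\<lambda>\<omega>. indicator D (V \<omega>) - prob q)"
      have X0m: "X0 \<in> borel_measurable M" unfolding X0_def using D by simp
      have "expectation (\<lambda>\<omega>. X0 \<omega> * (\<Prod>j\<in>S. indicator (B j) (Y j \<omega>))) = 0"
      proof (rule fourier_zero_imp_integral_prod_indicator_zero[where K=1])
        show "\<bar>X0 \<omega>\<bar> \<le> 1" for \<omega> by (auto simp: X0_def indicator_def)
        show "expectation (\<lambda>\<omega>. X0 \<omega> * cos (?N c \<omega>)) = 0" for c
          unfolding X0_def D(2) by (rule gaussian_uncorrelated_trig(1)[OF g2 u2 D(1)])
        show "expectation (\<lambda>\<omega>. X0 \<omega> * sin (?N c \<omega>)) = 0" for c
          unfolding X0_def D(2) by (rule gaussian_uncorrelated_trig(2)[OF g2 u2 D(1)])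
      qed (use S B Ym X0m in auto)
      also have "expectation (\<lambda>\<omega>. X0 \<omega> * (\<Prod>j\<in>S. indicator (B j) (Y j \<omega>)))
        = expectation (\<lambda>\<omega>. indicator (q \<inter> p) \<omega> - prob q * indicator p \<omega>)"
      proof (rule integral_cong_AE)
        have [measurable]: "Y j \<in> borel_measurable M" "B j \<in> sets borel" if "j \<in> S" for j
          using S Ym B that by auto
        show "(\<lambda>\<omega>. X0 \<omega> * (\<Prod>j\<in>S. indicator (B j) (Y j \<omega>))) \<in> borel_measurable M"
          using X0m by (intro borel_measurable_times borel_measurable_prod) auto
        show "(\<lambda>\<omega>. indicator (q \<inter> p) \<omega> - prob q * indicator p \<omega>) \<in> borel_measurable M"
          using q p by simp
        show "AE \<omega> in M. X0 \<omega> * (\<Prod>j\<in>S. indicator (B j) (Y j \<omega>))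
            = indicator (q \<inter> p) \<omega> - prob q * indicator p \<omega>"
          using ae AE_space
        proof eventually_elim
          case (elim \<omega>)
          have "(\<Prod>j\<in>S. indicator (B j) (Y j \<omega>)) = (indicator p \<omega> :: real)"
            using elim True S by (auto simp: indicator_def)
          then show ?case using elim D by (auto simp: X0_def indicator_def)
        qed
      qed
      also have "\<dots> = prob (q \<inter> p) - prob q * prob p"
        using q p by (simp add: emeasure_eq_measure)
      finally show ?thesis by simp
    qed
  qed
  moreover have "Int_stable Q"
  proof (rule Int_stableI)
    fix a b assume "a \<in> Q" "b \<in> Q"
    then obtain A B where "A \<in> sets borel" "B \<in> sets borel" "a = V -` A \<inter> space M" "b = V -` B \<inter> space M"
      by (auto simp: Q_def)
    then show "a \<inter> b \<in> Q" unfolding Q_def by (intro CollectI exI[of _ "A \<inter> B"]) auto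
  qed
  moreover have "Int_stable P"
  proof (rule Int_stableI)
    fix p p' assume "p \<in> P" "p' \<in> P"
    then obtain S B b S' B' b' where p: "p \<in> events" "p' \<in> events"
      and S: "finite S" "S \<subseteq> J" "\<forall>j\<in>S. B j \<in> sets borel" "finite S'" "S' \<subseteq> J" "\<forall>j\<in>S'. B' j \<in> sets borel"
      and ae: "AE \<omega> in M. \<omega> \<in> p \<longleftrightarrow> b \<and> (\<forall>j\<in>S. Y j \<omega> \<in> B j)"
        "AE \<omega> in M. \<omega> \<in> p' \<longleftrightarrow> b' \<and> (\<forall>j\<in>S'. Y j \<omega> \<in> B' j)"
      unfolding P_def by blast
    define C where "C j = (if j \<in> S then B j else UNIV) \<inter> (if j \<in> S' then B' j else UNIV)" for j
    have "AE \<omega> in M. \<omega> \<in> p \<inter> p' \<longleftrightarrow> (b \<and> b') \<and> (\<forall>j\<in>S \<union> S'. Y j \<omega> \<in> C j)"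
      using ae by eventually_elim (auto simp: C_def)
    moreover have "\<forall>j\<in>S \<union> S'. C j \<in> sets borel" using S by (auto simp: C_def)
    ultimately show "p \<inter> p' \<in> P"
      unfolding P_def using p S
      by (intro CollectI conjI exI[of _ "S \<union> S'"] exI[of _ C] exI[of _ "b \<and> b'"]) auto
  qed
  ultimately have ind: "indep_set (sigma_sets (space M) Q) (sigma_sets (space M) P)"
    by (rule indep_set_sigma_sets)
  have "G \<subseteq> P"
  proof
    fix A assume "A \<in> G"
    then consider j B where "j \<in> J" "B \<in> sets borel" "A = Y j -` B \<inter> space M" | "A \<in> null_sets M"
      by (auto simp: G_def)
    then show "A \<in> P"
    proof cases
      case 1
      then have "A \<in> events" using Ym by simp
      moreover have "AE \<omega> in M. \<omega> \<in> A \<longleftrightarrow> True \<and> (\<forall>i\<in>{j}. Y i \<omega> \<in> B)"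
        using 1 by (intro AE_I2) simp
      ultimately show ?thesis
        unfolding P_def using 1
        by (intro CollectI conjI exI[of _ "{j}"] exI[of _ "\<lambda>_. B"] exI[of _ True]) auto
    next
      case 2
      then have "AE \<omega> in M. \<omega> \<in> A \<longleftrightarrow> False \<and> (\<forall>i\<in>{}. Y i \<omega> \<in> UNIV)"
        using AE_not_in[OF 2] by simp
      with 2 show ?thesis
        unfolding P_def
        by (intro CollectI conjI exI[of _ "{}"] exI[of _ "\<lambda>_. UNIV"] exI[of _ False]) auto
    qed
  qed
  then have GP: "sigma_sets (space M) G \<subseteq> sigma_sets (space M) P"
    by (rule sigma_sets_mono')
  have GPow: "G \<subseteq> Pow (space M)"
    using \<open>G \<subseteq> P\<close> PE sets.space_closed[of M] by blast
  have XG: "{X -` A \<inter> space M | A. A \<in> sets borel} \<subseteq> sigma_sets (space M) G"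
    using measurable_sets[OF X[folded G_def]] GPow by (auto simp: sets_measure_of)
  have XP: "sigma_sets (space M) {X -` A \<inter> space M | A. A \<in> sets borel} \<subseteq> sigma_sets (space M) P"
    using XG GP by (intro sigma_sets_mono) blast
  have "indep_set (sigma_sets (space M) {V -` A \<inter> space M | A. A \<in> sets borel})
      (sigma_sets (space M) {X -` A \<inter> space M | A. A \<in> sets borel})"
    using ind XP unfolding indep_sets2_eq Q_def by blast
  moreover have "X \<in> borel_measurable M"
  proof (rule measurableI)
    fix A :: "real set" assume "A \<in> sets borel"
    then have "X -` A \<inter> space M \<in> sigma_sets (space M) G" using XG by blast
    also have "\<dots> \<subseteq> events"
      using \<open>G \<subseteq> P\<close> PE by (intro sets.sigma_sets_subset) blast
    finally show "X -` A \<inter> space M \<in> events" .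
  qed auto
  ultimately show ?thesis by (simp add: indep_var_eq)
qed

section \<open>White noise and the Walsh integral\<close>

lemma half_plane_borel: "half_plane \<in> sets borel"
  unfolding half_plane_def by (intro borel_closed closed_Times) auto

lemma space_st_lebesgue: "space st_lebesgue = half_plane"
  unfolding st_lebesgue_def by (simp add: space_restrict_space)

lemma sets_st_lebesgue: "A \<in> sets st_lebesgue \<longleftrightarrow> A \<in> sets borel \<and> A \<subseteq> half_plane"
  unfolding st_lebesgue_def using half_plane_borel by (subst sets_restrict_space_iff) auto

lemma emeasure_st_lebesgue: "A \<subseteq> half_plane \<Longrightarrow> emeasure st_lebesgue A = emeasure lborel A"
  unfolding st_lebesgue_def using half_plane_borel by (intro emeasure_restrict_space) auto

lemma sigma_finite_st_lebesgue: "sigma_finite_measure st_lebesgue"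
  unfolding st_lebesgue_def using half_plane_borel
  by (intro sigma_finite_measure_restrict_space sigma_finite_lborel) auto

lemma rectangle_finite_sets:
  assumes "T \<in> sets borel" "T \<subseteq> {0..b}" "A \<in> finite_sets lborel"
  shows "T \<times> A \<in> finite_sets (st_lebesgue :: (real \<times> real) measure)"
proof -
  have A: "A \<in> sets borel" "emeasure lborel A < \<infinity>" using assms by (auto simp: finite_sets_def)
  have hp: "T \<times> A \<subseteq> half_plane" using assms by (auto simp: half_plane_def)
  have "emeasure lborel T \<le> emeasure lborel {0..b}" using assms by (intro emeasure_mono) auto
  also have "\<dots> < \<infinity>" by (cases "0 \<le> b") auto
  finally have T: "emeasure lborel T < \<infinity>" .
  have "emeasure (lborel :: (real \<times> real) measure) (T \<times> A) = emeasure (lborel \<Otimes>\<^sub>M lborel) (T \<times> A)"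
    by (simp add: lborel_prod)
  also have "\<dots> = emeasure lborel T * emeasure lborel A"
    using assms A by (intro lborel.emeasure_pair_measure_Times) auto
  also have "\<dots> < \<infinity>" using T A by (simp add: ennreal_mult_less_top)
  finally have "emeasure (lborel :: (real \<times> real) measure) (T \<times> A) < \<infinity>" .
  moreover have "T \<times> A \<in> sets (borel \<Otimes>\<^sub>M borel)" using assms(1) A(1) by (rule pair_measureI)
  then have "T \<times> A \<in> sets borel" unfolding borel_prod .
  ultimately show ?thesis
    using hp by (simp add: finite_sets_def sets_st_lebesgue emeasure_st_lebesgue)
qed

definition linear_span :: "'i set \<Rightarrow> ('i \<Rightarrow> 'a \<Rightarrow> real) \<Rightarrow> ('a \<Rightarrow> real) set" where
  "linear_span T X = {Y. \<exists>S c. finite S \<and> S \<subseteq> T \<and> Y = (\<lambda>\<omega>. \<Sum>i\<in>S. c i * X i \<omega>)}"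

lemma linear_span_zero: "(\<lambda>\<omega>. 0) \<in> linear_span T X"
  unfolding linear_span_def by (intro CollectI exI[of _ "{}"]) auto

lemma linear_span_base: "i \<in> T \<Longrightarrow> X i \<in> linear_span T X"
  unfolding linear_span_def by (intro CollectI exI[of _ "{i}"] exI[of _ "\<lambda>_. 1"]) auto

lemma linear_span_cmult: "Y \<in> linear_span T X \<Longrightarrow> (\<lambda>\<omega>. r * Y \<omega>) \<in> linear_span T X"
proof -
  assume "Y \<in> linear_span T X"
  then obtain S c where "finite S" "S \<subseteq> T" "Y = (\<lambda>\<omega>. \<Sum>i\<in>S. c i * X i \<omega>)"
    by (auto simp: linear_span_def)
  then show ?thesis
    unfolding linear_span_def
    by (intro CollectI exI[of _ S] exI[of _ "\<lambda>i. r * c i"]) (auto simp: sum_distrib_left mult.assoc)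
qed

lemma linear_span_add:
  assumes "Y \<in> linear_span T X" "Z \<in> linear_span T X"
  shows "(\<lambda>\<omega>. Y \<omega> + Z \<omega>) \<in> linear_span T X"
proof -
  obtain S c where S: "finite S" "S \<subseteq> T" "Y = (\<lambda>\<omega>. \<Sum>i\<in>S. c i * X i \<omega>)"
    using assms(1) by (auto simp: linear_span_def)
  obtain S' c' where S': "finite S'" "S' \<subseteq> T" "Z = (\<lambda>\<omega>. \<Sum>i\<in>S'. c' i * X i \<omega>)"
    using assms(2) by (auto simp: linear_span_def)
  let ?d = "\<lambda>i. (if i \<in> S then c i else 0) + (if i \<in> S' then c' i else 0)"
  have "Y \<omega> + Z \<omega> = (\<Sum>i\<in>S \<union> S'. ?d i * X i \<omega>)" for \<omega>
  proof -
    have "Y \<omega> = (\<Sum>i\<in>S \<union> S'. (if i \<in> S then c i else 0) * X i \<omega>)"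
      unfolding S(3) using S(1) S'(1) by (intro sum.mono_neutral_cong_left) auto
    moreover have "Z \<omega> = (\<Sum>i\<in>S \<union> S'. (if i \<in> S' then c' i else 0) * X i \<omega>)"
      unfolding S'(3) using S(1) S'(1) by (intro sum.mono_neutral_cong_left) auto
    ultimately show ?thesis by (simp only: distrib_right sum.distrib)
  qed
  then show ?thesis
    unfolding linear_span_def using S S'
    by (intro CollectI exI[of _ "S \<union> S'"] exI[of _ ?d]) auto
qed

lemma linear_span_sum:
  assumes "\<And>j. j \<in> J \<Longrightarrow> Y j \<in> linear_span T X"
  shows "(\<lambda>\<omega>. \<Sum>j\<in>J. c j * Y j \<omega>) \<in> linear_span T X"
  using assms
proof (induction J rule: infinite_finite_induct)
  case (insert j J)
  then show ?case by (simp add: linear_span_add linear_span_cmult)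
qed (simp_all add: linear_span_zero)

lemma centered_gaussian_linear_span:
  "centered_gaussian_process M T X \<Longrightarrow> Y \<in> linear_span T X \<Longrightarrow> centered_gaussian M Y"
  unfolding centered_gaussian_process_def linear_span_def by blast

locale white_noise = prob_space M for M :: "'a measure" +
  fixes W :: "(real \<times> real) set \<Rightarrow> 'a \<Rightarrow> real"
  assumes white_noise: "space_time_white_noise M W"
begin

abbreviation "\<F> \<equiv> noise_filtration M W"
abbreviation "FS \<equiv> finite_sets st_lebesgue"

lemma span_gaussian: "Y \<in> linear_span FS W \<Longrightarrow> centered_gaussian M Y"
  using white_noise centered_gaussian_linear_span unfolding space_time_white_noise_def by blast

lemma W_gaussian: "A \<in> FS \<Longrightarrow> centered_gaussian M (W A)"
  by (intro span_gaussian linear_span_base)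

lemma W_measurable: "A \<in> FS \<Longrightarrow> W A \<in> borel_measurable M"
  by (intro centered_gaussian_measurable W_gaussian)

lemma W_square_integrable: "A \<in> FS \<Longrightarrow> square_integrable M (W A)"
  by (intro centered_gaussian_square_integrable W_gaussian)

lemma W_mean: "A \<in> FS \<Longrightarrow> expectation (W A) = 0"
  by (intro centered_gaussian_mean W_gaussian)

lemma W_covariance:
  "A \<in> FS \<Longrightarrow> B \<in> FS \<Longrightarrow> expectation (\<lambda>\<omega>. W A \<omega> * W B \<omega>) = measure st_lebesgue (A \<inter> B)"
  using white_noise unfolding space_time_white_noise_def by blast

lemma history_rectangle: "A \<in> finite_sets lborel \<Longrightarrow> {0..s} \<times> A \<in> FS"
  by (rule rectangle_finite_sets[of _ s]) auto

lemma filtration_measurable: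
  assumes "X \<in> borel_measurable (\<F> t)"
  shows "X \<in> borel_measurable M"
proof -
  let ?G = "{W ({0..s} \<times> A) -` B \<inter> space M | s A B.
           0 \<le> s \<and> s \<le> t \<and> A \<in> finite_sets lborel \<and> B \<in> sets borel} \<union> null_sets M"
  have G: "?G \<subseteq> events"
    using measurable_sets[OF W_measurable[OF history_rectangle]] by auto
  have "sets (\<F> t) = sigma_sets (space M) ?G"
    unfolding noise_filtration_def by (rule sets_measure_of[OF order_trans[OF G sets.space_closed]])
  then have "sets (\<F> t) \<subseteq> events"
    using sets.sigma_sets_subset[OF G] by simp
  moreover have "space (\<F> t) = space M"
    unfolding noise_filtration_def by (rule space_measure_of_conv)
  ultimately show ?thesis using assms measurable_mono[of borel borel "\<F> t" M] by auto
qed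

lemma future_rectangle:
  assumes "0 \<le> a" "A \<in> finite_sets lborel"
  shows "{a<..b} \<times> A \<in> FS"
  using assms by (intro rectangle_finite_sets[of _ b]) auto

text \<open>The noise on a rectangle after time \<open>a\<close> is uncorrelated with the past. The second claim adjoins the
  residual of the projection of \<open>W S\<close> onto \<open>W R\<close> to the past: it too is uncorrelated with \<open>W R\<close>, so that
  \<open>W R\<close> is independent of the past and the residual together, although \<open>S\<close> may reach into the past
  and the future at once.\<close>
lemma future_noise_indep:
  assumes a: "0 \<le> a" and A: "A \<in> finite_sets lborel"
    and X: "X \<in> borel_measurable (\<F> a)" and S: "S \<in> FS"
    and R_def: "R = {a<..b} \<times> A"
    and \<beta>: "measure st_lebesgue (R \<inter> S) = \<beta> * measure st_lebesgue R"
  shows "indep_var borel (W R) borel X"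
    and "indep_var borel (W R) borel (\<lambda>\<omega>. X \<omega> * (W S \<omega> - \<beta> * W R \<omega>))"
proof -
  have R: "R \<in> FS" unfolding R_def by (rule future_rectangle[OF a A])
  \<comment> \<open>The index \<open>None\<close> stands for the residual, \<open>Some P\<close> for the noise on a rectangle of the past.\<close>
  define J :: "(real \<times> real) set option set"
    where "J = insert None (Some ` {{0..s} \<times> A' | s A'. s \<le> a \<and> A' \<in> finite_sets lborel})"
  define Y where "Y j = (case j of None \<Rightarrow> \<lambda>\<omega>. W S \<omega> - \<beta> * W R \<omega> | Some P \<Rightarrow> W P)" for j
  have Ys: "Y j \<in> linear_span FS W" if "j \<in> J" for j
  proof (cases j)
    case None
    have "(\<lambda>\<omega>. W S \<omega> + (- \<beta>) * W R \<omega>) \<in> linear_span FS W"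
      by (intro linear_span_add linear_span_cmult linear_span_base S R)
    then show ?thesis by (simp add: Y_def None)
  next
    case (Some P)
    then have "P \<in> FS" using that history_rectangle by (auto simp: J_def)
    then show ?thesis by (simp add: Y_def Some linear_span_base)
  qed
  have gauss: "centered_gaussian M (\<lambda>\<omega>. \<theta> * W R \<omega> + (\<Sum>j\<in>T. c j * Y j \<omega>))" if "T \<subseteq> J" for T c \<theta>
    using that Ys by (intro span_gaussian linear_span_add linear_span_cmult linear_span_base R linear_span_sum) auto
  have uncorr: "expectation (\<lambda>\<omega>. W R \<omega> * Y j \<omega>) = 0" if jJ: "j \<in> J" for j
  proof (cases j)
    case None
    have "expectation (\<lambda>\<omega>. W R \<omega> * Y j \<omega>)
        = expectation (\<lambda>\<omega>. W R \<omega> * W S \<omega> - \<beta> * (W R \<omega> * W R \<omega>))"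
      by (simp add: Y_def None algebra_simps)
    also have "\<dots> = measure st_lebesgue (R \<inter> S) - \<beta> * measure st_lebesgue (R \<inter> R)"
      using square_integrable_mult[OF W_square_integrable W_square_integrable] R S
      by (simp add: W_covariance del: Int_absorb)
    finally show ?thesis using \<beta> by simp
  next
    case (Some P)
    then obtain s A' where P: "P = {0..s} \<times> A'" "s \<le> a" "A' \<in> finite_sets lborel"
      using jJ by (auto simp: J_def)
    then have "R \<inter> P = {}" by (auto simp: R_def)
    then show ?thesis
      using W_covariance[OF R history_rectangle[OF P(3), of s]] by (simp add: Y_def Some P(1))
  qed
  define G where "G = {Y j -` B \<inter> space M | j B. j \<in> J \<and> B \<in> sets borel} \<union> null_sets M"
  have GPow: "G \<subseteq> Pow (space M)"
    unfolding G_def using sets.space_closed[of M] by auto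
  let ?G = "sigma (space M) G"
  have spG: "space ?G = space M" by (rule space_measure_of_conv)
  have "sets (\<F> a) \<subseteq> sets ?G"
  proof -
    have sub: "{W ({0..s} \<times> A) -` B \<inter> space M | s A B.
           0 \<le> s \<and> s \<le> a \<and> A \<in> finite_sets lborel \<and> B \<in> sets borel} \<union> null_sets M \<subseteq> G"
    proof -
      have "W ({0..s} \<times> A') -` B \<inter> space M \<in> G"
        if "s \<le> a" "A' \<in> finite_sets lborel" "B \<in> sets borel" for s A' B
      proof -
        have "Some ({0..s} \<times> A') \<in> J" using that by (auto simp: J_def)
        then have "Y (Some ({0..s} \<times> A')) -` B \<inter> space M \<in> G"
          unfolding G_def using that(3) by blast
        then show ?thesis by (simp add: Y_def)
      qed
      moreover have "null_sets M \<subseteq> G" by (simp add: G_def)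
      ultimately show ?thesis by blast
    qed
    then show ?thesis
      unfolding noise_filtration_def using GPow
      by (simp only: sets_measure_of order_trans[OF sub GPow]) (rule sigma_sets_mono')
  qed
  moreover have "space (\<F> a) = space M"
    unfolding noise_filtration_def by (rule space_measure_of_conv)
  ultimately have XG: "X \<in> borel_measurable ?G"
    using X measurable_mono[of borel borel "\<F> a" ?G] spG by auto
  have ZG: "Y None \<in> borel_measurable ?G"
  proof (rule measurableI)
    fix B :: "real set" assume "B \<in> sets borel"
    then have "Y None -` B \<inter> space M \<in> G" unfolding G_def J_def by blast
    then show "Y None -` B \<inter> space ?G \<in> sets ?G" using GPow spG by simp
  qed auto
  have "(\<lambda>\<omega>. X \<omega> * Y None \<omega>) \<in> borel_measurable ?G"
    using XG ZG by simp
  with XG show "indep_var borel (W R) borel X"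
    "indep_var borel (W R) borel (\<lambda>\<omega>. X \<omega> * (W S \<omega> - \<beta> * W R \<omega>))"
    using gaussian_uncorrelated_indep[of J "W R" Y, OF gauss uncorr] unfolding G_def
    by (simp_all add: Y_def)
qed

text \<open>Writing \<open>W S = \<beta> W R + (W S - \<beta> W R)\<close>, the residual part contributes nothing by independence, and the
  rest is \<open>\<beta> E[X] E[(W R)\<^sup>2]\<close>.\<close>
lemma elementary_integral_pairing:
  assumes e: "is_elementary M \<F> (a, b, A, X)" and S: "S \<in> FS"
  defines "R \<equiv> {a<..b} \<times> A"
  shows "square_integrable M (\<lambda>\<omega>. X \<omega> * W R \<omega>)"
    and "expectation (\<lambda>\<omega>. X \<omega> * W R \<omega>) = 0"
    and "expectation (\<lambda>\<omega>. X \<omega> * W R \<omega> * W S \<omega>) = expectation X * measure st_lebesgue (R \<inter> S)"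
proof -
  obtain c where a: "0 \<le> a" and A: "A \<in> finite_sets lborel" and X: "X \<in> borel_measurable (\<F> a)"
    and c: "\<And>\<omega>. \<omega> \<in> space M \<Longrightarrow> \<bar>X \<omega>\<bar> \<le> c"
    using e by auto
  have R: "R \<in> FS" unfolding R_def by (rule future_rectangle[OF a A])
  have XM: "X \<in> borel_measurable M" by (rule filtration_measurable[OF X])
  have Xi: "integrable M X" using XM c by (intro integrable_const_bound[where B=c]) auto
  note L2X = square_integrable_bounded_mult[OF _ XM c]
  show L2: "square_integrable M (\<lambda>\<omega>. X \<omega> * W R \<omega>)"
    by (rule L2X[OF W_square_integrable[OF R]])
  define \<beta> where "\<beta> = measure st_lebesgue (R \<inter> S) / measure st_lebesgue R"
  have fin: "emeasure st_lebesgue R < \<infinity>" "R \<in> sets st_lebesgue" "S \<in> sets st_lebesgue"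
    using R S by (auto simp: finite_sets_def)
  \<comment> \<open>If \<open>R\<close> is null, the value \<open>\<beta> = 0\<close> of the division is the right coefficient.\<close>
  have \<beta>: "measure st_lebesgue (R \<inter> S) = \<beta> * measure st_lebesgue R"
  proof (cases "measure st_lebesgue R = 0")
    case True
    have "measure st_lebesgue (R \<inter> S) \<le> measure st_lebesgue R"
      using fin by (intro measure_mono_fmeasurable) (auto simp: fmeasurable_def)
    then show ?thesis using True by (simp add: measure_le_0_iff)
  qed (simp add: \<beta>_def)
  note ind = future_noise_indep[OF a A X S R_def[THEN meta_eq_to_obj_eq] \<beta>]
  have WRi: "integrable M (W R)" by (rule square_integrable_integrable[OF W_square_integrable[OF R]])
  show "expectation (\<lambda>\<omega>. X \<omega> * W R \<omega>) = 0"
    using indep_var_lebesgue_integral[OF ind(1) WRi Xi] W_mean[OF R] by (simp add: mult.commute)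
  have Z: "square_integrable M (\<lambda>\<omega>. X \<omega> * (W S \<omega> - \<beta> * W R \<omega>))"
    by (intro L2X square_integrable_diff square_integrable_cmult W_square_integrable R S)
  have p0: "expectation (\<lambda>\<omega>. W R \<omega> * (X \<omega> * (W S \<omega> - \<beta> * W R \<omega>))) = 0"
    by (rule indep_var_lebesgue_integral[OF ind(2) WRi square_integrable_integrable[OF Z],
          unfolded W_mean[OF R] mult_zero_left])
  have ind2: "indep_var borel (\<lambda>\<omega>. (W R \<omega>)\<^sup>2) borel X"
    by (rule indep_var_compose[OF ind(1), of "\<lambda>x. x\<^sup>2" borel "\<lambda>x. x" borel, unfolded comp_def])
       measurable
  have i2: "integrable M (\<lambda>\<omega>. (W R \<omega>)\<^sup>2)"
    using W_square_integrable[OF R] by (simp add: square_integrable_def)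
  have p2: "expectation (\<lambda>\<omega>. (W R \<omega>)\<^sup>2 * X \<omega>) = measure st_lebesgue R * expectation X"
    using indep_var_lebesgue_integral[OF ind2 i2 Xi] W_covariance[OF R R] by (simp add: power2_eq_square)
  have "expectation (\<lambda>\<omega>. X \<omega> * W R \<omega> * W S \<omega>)
     = expectation (\<lambda>\<omega>. W R \<omega> * (X \<omega> * (W S \<omega> - \<beta> * W R \<omega>)) + \<beta> * ((W R \<omega>)\<^sup>2 * X \<omega>))"
    by (simp add: power2_eq_square algebra_simps)
  also have "\<dots> = \<beta> * (measure st_lebesgue R * expectation X)"
  proof (subst Bochner_Integration.integral_add)
    show "integrable M (\<lambda>\<omega>. W R \<omega> * (X \<omega> * (W S \<omega> - \<beta> * W R \<omega>)))"
      by (rule square_integrable_mult[OF W_square_integrable[OF R] Z])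
    show "integrable M (\<lambda>\<omega>. \<beta> * ((W R \<omega>)\<^sup>2 * X \<omega>))"
      by (rule integrable_mult_right[OF indep_var_integrable[OF ind2 i2 Xi]])
  qed (simp only: p0 p2 integral_mult_right_zero add_0_left)
  finally show "expectation (\<lambda>\<omega>. X \<omega> * W R \<omega> * W S \<omega>) = expectation X * measure st_lebesgue (R \<inter> S)"
    using \<beta> by simp
qed

abbreviation "\<P> \<equiv> st_lebesgue \<Otimes>\<^sub>M M"

lemma pair_sigma_finite_st: "pair_sigma_finite st_lebesgue M"
  using sigma_finite_st_lebesgue sigma_finite_measure_axioms by (simp add: pair_sigma_finite_def)

lemma rectangle_integrable:
  assumes X: "X \<in> borel_measurable M" and c: "\<And>\<omega>. \<omega> \<in> space M \<Longrightarrow> \<bar>X \<omega>\<bar> \<le> c" and R: "R \<in> FS"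
  shows "integrable \<P> (\<lambda>x. X (snd x) * indicator R (fst x))"
    and "(\<integral>x. X (snd x) * indicator R (fst x) \<partial>\<P>) = expectation X * measure st_lebesgue R"
proof -
  interpret P: pair_sigma_finite st_lebesgue M by (rule pair_sigma_finite_st)
  have fin: "emeasure st_lebesgue R < \<infinity>" and [measurable]: "R \<in> sets st_lebesgue"
    using R by (auto simp: finite_sets_def)
  note X[measurable]
  have e: "emeasure \<P> (R \<times> space M) = emeasure st_lebesgue R"
    by (simp add: emeasure_pair_measure_Times emeasure_space_1)
  show i: "integrable \<P> (\<lambda>x. X (snd x) * indicator R (fst x))"
  proof (rule Bochner_Integration.integrable_bound)
    show "integrable \<P> (\<lambda>x. c * indicator (R \<times> space M) x)"
      using fin e by (intro integrable_mult_right integrable_real_indicator) auto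
    show "AE x in \<P>. norm (X (snd x) * indicator R (fst x)) \<le> norm (c * indicator (R \<times> space M) x)"
      using c by (intro AE_I2) (fastforce simp: space_pair_measure indicator_def)
  qed measurable
  have "(\<integral>x. X (snd x) * indicator R (fst x) \<partial>\<P>) = (\<integral>p. (\<integral>\<omega>. X \<omega> * indicator R p \<partial>M) \<partial>st_lebesgue)"
    using P.integral_fst'[OF i] by simp
  also have "\<dots> = expectation X * measure st_lebesgue R" by simp
  finally show "(\<integral>x. X (snd x) * indicator R (fst x) \<partial>\<P>) = expectation X * measure st_lebesgue R" .
qed

lemma indicator_square_integrable: 
  assumes "S \<in> FS"
  shows "square_integrable \<P> (\<lambda>x. indicator S (fst x))"
proof -
  have [measurable]: "S \<in> sets st_lebesgue" using assms by (auto simp: finite_sets_def)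
  have "integrable \<P> (\<lambda>x. 1 * indicator S (fst x) :: real)"
    using rectangle_integrable(1)[of "\<lambda>_. 1" 1 S] assms by simp
  moreover have "(indicator S q :: real)\<^sup>2 = indicator S q" for q
    by (simp add: indicator_def)
  ultimately show ?thesis unfolding square_integrable_def by simp
qed

lemma simple_pairing:
  assumes "\<And>e. e \<in> set es \<Longrightarrow> is_elementary M \<F> e" and S: "S \<in> FS"
  shows "square_integrable M (simple_integral W es) \<and>
    square_integrable \<P> (\<lambda>x. simple_process es (fst (fst x)) (snd (fst x)) (snd x)) \<and>
    expectation (simple_integral W es) = 0 \<and>
    expectation (\<lambda>\<omega>. simple_integral W es \<omega> * W S \<omega>) =
      (\<integral>x. simple_process es (fst (fst x)) (snd (fst x)) (snd x) * indicator S (fst x) \<partial>\<P>)"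
  using assms(1)
proof (induction es)
  case Nil
  then show ?case by (simp add: simple_integral_def simple_process_def square_integrable_def)
next
  case (Cons e es)
  obtain a b A X where e: "e = (a, b, A, X)" by (cases e) auto
  define R where "R = {a<..b} \<times> A"
  have el: "is_elementary M \<F> (a, b, A, X)" using Cons.prems e by (simp del: is_elementary.simps)
  then obtain c where a: "0 \<le> a" and A: "A \<in> finite_sets lborel" and X: "X \<in> borel_measurable (\<F> a)"
    and c: "\<And>\<omega>. \<omega> \<in> space M \<Longrightarrow> \<bar>X \<omega>\<bar> \<le> c"
    by auto
  have XM: "X \<in> borel_measurable M" by (rule filtration_measurable[OF X])
  have R: "R \<in> FS" unfolding R_def by (rule future_rectangle[OF a A])
  have RS: "R \<inter> S \<in> FS"
    using R S emeasure_mono[of "R \<inter> S" R st_lebesgue] by (auto simp: finite_sets_def)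
  note p = elementary_integral_pairing[OF el S, folded R_def]
  have IH: "square_integrable M (simple_integral W es)"
    "square_integrable \<P> (\<lambda>x. simple_process es (fst (fst x)) (snd (fst x)) (snd x))"
    "expectation (simple_integral W es) = 0"
    "expectation (\<lambda>\<omega>. simple_integral W es \<omega> * W S \<omega>) =
      (\<integral>x. simple_process es (fst (fst x)) (snd (fst x)) (snd x) * indicator S (fst x) \<partial>\<P>)"
    using Cons by simp_all
  have si: "simple_integral W (e # es) = (\<lambda>\<omega>. X \<omega> * W R \<omega> + simple_integral W es \<omega>)"
    by (simp add: simple_integral_def e R_def fun_eq_iff)
  have sp: "simple_process (e # es) (fst (fst x)) (snd (fst x)) (snd x)
      = X (snd x) * indicator R (fst x) + simple_process es (fst (fst x)) (snd (fst x)) (snd x)"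
    for x :: "(real \<times> real) \<times> 'a"
    by (cases x) (auto simp: simple_process_def e R_def indicator_def)
  have q: "square_integrable \<P> (\<lambda>x. X (snd x) * indicator R (fst x))"
    using c by (intro square_integrable_bounded_mult[where c=c] indicator_square_integrable R)
      (auto simp: space_pair_measure intro: XM measurable_compose[OF measurable_snd])
  note z = indicator_square_integrable[OF S]
  have i: "integrable M (\<lambda>\<omega>. X \<omega> * W R \<omega>)" "integrable M (simple_integral W es)"
    using p(1) IH(1) square_integrable_integrable by auto
  have j: "integrable M (\<lambda>\<omega>. X \<omega> * W R \<omega> * W S \<omega>)" "integrable M (\<lambda>\<omega>. simple_integral W es \<omega> * W S \<omega>)"
    using p(1) IH(1) W_square_integrable[OF S] square_integrable_mult by auto
  have k: "integrable \<P> (\<lambda>x. X (snd x) * indicator R (fst x) * indicator S (fst x))"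
    "integrable \<P> (\<lambda>x. simple_process es (fst (fst x)) (snd (fst x)) (snd x) * indicator S (fst x))"
    using q IH(2) z square_integrable_mult by auto
  have "(\<integral>x. X (snd x) * indicator R (fst x) * indicator S (fst x) \<partial>\<P>)
      = (\<integral>x. X (snd x) * indicator (R \<inter> S) (fst x) \<partial>\<P>)"
    by (intro Bochner_Integration.integral_cong) (auto simp: indicator_def)
  also have "\<dots> = expectation X * measure st_lebesgue (R \<inter> S)"
    by (rule rectangle_integrable(2)[OF XM c RS])
  finally have key: "expectation (\<lambda>\<omega>. X \<omega> * W R \<omega> * W S \<omega>)
      = (\<integral>x. X (snd x) * indicator R (fst x) * indicator S (fst x) \<partial>\<P>)"
    using p(3) by simp
  show ?case
    unfolding si sp using IH i j k key p q
    by (auto simp: distrib_right intro!: square_integrable_add)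
qed

text \<open>This replaces the Ito isometry. Testing against the noise on a deterministic set is linear in the
  integrand, so no products of two random coefficients appear.\<close>
lemma walsh_integral_pairing:
  assumes "has_walsh_integral M W f Y" and S: "S \<in> FS"
  defines "F \<equiv> \<lambda>x. f (fst (fst x)) (snd (fst x)) (snd x)"
  shows "square_integrable M Y" and "expectation Y = 0"
    and "square_integrable \<P> F"
    and "expectation (\<lambda>\<omega>. Y \<omega> * W S \<omega>) = (\<integral>x. F x * indicator S (fst x) \<partial>\<P>)"
proof -
  obtain es where Fm: "F \<in> borel_measurable \<P>" and Ym: "Y \<in> borel_measurable M"
    and es: "\<And>n e. e \<in> set (es n) \<Longrightarrow> is_elementary M \<F> e"
    and l1: "(\<lambda>n. \<integral>\<^sup>+x. ennreal ((F x - simple_process (es n) (fst (fst x)) (snd (fst x)) (snd x))\<^sup>2) \<partial>\<P>) \<longlonglongrightarrow> 0"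
    and l2: "(\<lambda>n. \<integral>\<^sup>+\<omega>. ennreal ((Y \<omega> - simple_integral W (es n) \<omega>)\<^sup>2) \<partial>M) \<longlonglongrightarrow> 0"
    using assms(1) unfolding has_walsh_integral_def jointly_measurable_def F_def
    by (auto simp: case_prod_beta')
  have s: "square_integrable M (simple_integral W (es n))" (is ?s1)
    "square_integrable \<P> (\<lambda>x. simple_process (es n) (fst (fst x)) (snd (fst x)) (snd x))" (is ?s2)
    "expectation (simple_integral W (es n)) = 0" (is ?s3)
    "expectation (\<lambda>\<omega>. simple_integral W (es n) \<omega> * W S \<omega>) =
      (\<integral>x. simple_process (es n) (fst (fst x)) (snd (fst x)) (snd x) * indicator S (fst x) \<partial>\<P>)" (is ?s4) for n
  proof -
    have "\<And>e. e \<in> set (es n) \<Longrightarrow> is_elementary M \<F> e" by (rule es)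
    note * = simple_pairing[OF this S]
    show ?s1 ?s2 ?s3 ?s4 using * by blast+
  qed
  show "square_integrable M Y" by (rule L2_limit_square_integrable[OF Ym s(1) l2])
  show "square_integrable \<P> F" by (rule L2_limit_square_integrable[OF Fm s(2) l1])
  have "(\<lambda>n. expectation (\<lambda>\<omega>. simple_integral W (es n) \<omega> * 1)) \<longlonglongrightarrow> expectation (\<lambda>\<omega>. Y \<omega> * 1)"
    by (rule L2_limit_pairing[OF Ym s(1) l2 square_integrable_const])
  then show "expectation Y = 0" by (simp add: s(3) LIMSEQ_const_iff)
  show "expectation (\<lambda>\<omega>. Y \<omega> * W S \<omega>) = (\<integral>x. F x * indicator S (fst x) \<partial>\<P>)"
    using L2_limit_pairing[OF Ym s(1) l2 W_square_integrable[OF S]]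
      L2_limit_pairing[OF Fm s(2) l1 indicator_square_integrable[OF S]]
    unfolding s(4) by (rule LIMSEQ_unique)
qed

end

section \<open>The coefficient, the cone and the initial datum\<close>

text \<open>On a connected set without zeros \<open>\<rho>\<close> keeps its sign. If \<open>\<sigma> \<noteq> 0\<close> this set is the line; if \<open>\<sigma> = 0\<close> it is
  the positive half line, and on the other half line \<open>\<bar>\<rho> v\<bar> = \<bar>lam\<bar> \<bar>v\<bar>\<close> gives the bound whatever
  the sign is. The one-sided inequality allows passing to expectations:
  \<open>\<bar>E[\<rho> X]\<bar>\<close> is at least \<open>\<bar>lam\<bar> E[X]\<close> for integrable \<open>X\<close>.\<close>
lemma sign_dominates_linear:
  fixes \<rho> :: "real \<Rightarrow> real"
  assumes cont: "continuous_on UNIV \<rho>"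
    and sq: "\<And>v. \<bar>\<rho> v\<bar>\<^sup>2 = lam\<^sup>2 * (\<sigma>\<^sup>2 + v\<^sup>2)" and lam: "lam \<noteq> 0"
  shows "\<exists>\<epsilon>\<in>{1, -1}. \<forall>v. \<epsilon> * \<rho> v \<ge> \<bar>lam\<bar> * v"
proof -
  have big: "\<bar>lam\<bar> * \<bar>v\<bar> \<le> \<bar>\<rho> v\<bar>" for v
  proof (rule power2_le_imp_le)
    show "(\<bar>lam\<bar> * \<bar>v\<bar>)\<^sup>2 \<le> \<bar>\<rho> v\<bar>\<^sup>2"
      unfolding sq by (simp add: power_mult_distrib distrib_left)
  qed simp
  have nz: "\<rho> v \<noteq> 0" if "v > 0 \<or> \<sigma> \<noteq> 0" for v
    using sq[of v] that lam by (auto simp: sum_power2_eq_zero_iff)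
  have same_sign: "sgn (\<rho> v) = sgn (\<rho> 1)" if v: "v > 0 \<or> \<sigma> \<noteq> 0" for v
  proof (rule ccontr)
    assume "sgn (\<rho> v) \<noteq> sgn (\<rho> 1)"
    with nz[OF v] nz[of 1] have "\<rho> v < 0 \<and> 0 < \<rho> 1 \<or> \<rho> 1 < 0 \<and> 0 < \<rho> v"
      by (auto simp: sgn_if split: if_splits)
    then have "0 \<in> closed_segment (\<rho> v) (\<rho> 1)"
      by (auto simp: closed_segment_eq_real_ivl)
    moreover have "connected (\<rho> ` closed_segment v 1)"
      by (intro connected_continuous_image continuous_on_subset[OF cont]) auto
    then have "closed_segment (\<rho> v) (\<rho> 1) \<subseteq> \<rho> ` closed_segment v 1"
      by (intro closed_segment_subset) (auto simp: connected_convex_1)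
    ultimately obtain w where "w \<in> closed_segment v 1" "\<rho> w = 0" by force
    then show False using nz[of w] v by (auto simp: closed_segment_eq_real_ivl split: if_splits)
  qed
  have "sgn (\<rho> 1) * \<rho> v \<ge> \<bar>lam\<bar> * v" for v
  proof (cases "v > 0 \<or> \<sigma> \<noteq> 0")
    case True
    then have "sgn (\<rho> 1) * \<rho> v = \<bar>\<rho> v\<bar>" using same_sign by (metis abs_sgn mult.commute)
    moreover have "\<bar>lam\<bar> * v \<le> \<bar>lam\<bar> * \<bar>v\<bar>" by (intro mult_left_mono) auto
    ultimately show ?thesis using big[of v] by simp
  next
    case False
    then have v: "v \<le> 0" and \<sigma>: "\<sigma> = 0" by auto
    have "\<bar>\<rho> v\<bar>\<^sup>2 = (\<bar>lam\<bar> * \<bar>v\<bar>)\<^sup>2"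
      unfolding sq \<sigma> by (simp add: power_mult_distrib)
    then have "\<bar>\<rho> v\<bar> = \<bar>lam\<bar> * \<bar>v\<bar>"
      by (rule power2_eq_imp_eq) auto
    moreover have "\<bar>sgn (\<rho> 1) * \<rho> v\<bar> \<le> \<bar>\<rho> v\<bar>" by (auto simp: sgn_if)
    ultimately show ?thesis using v by (simp add: abs_le_iff)
  qed
  moreover have "sgn (\<rho> 1) \<in> {1, -1}" using nz[of 1] by (auto simp: sgn_if)
  ultimately show ?thesis by blast
qed

text \<open>The points of the half plane up to time \<open>T\<close> lying between the characteristic \<open>\<theta> y = \<kappa> s\<close> through the
  origin and its translate by \<open>\<delta>\<close>, on the outer side. The sign \<open>\<theta>\<close> selects one of the two lines.\<close>
definition characteristic_strip :: "real \<Rightarrow> real \<Rightarrow> real \<Rightarrow> real \<Rightarrow> (real \<times> real) set" where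
  "characteristic_strip \<kappa> \<theta> T \<delta> = {(s, y). 0 \<le> s \<and> s \<le> T \<and> 0 < \<theta> * y - \<kappa> * s \<and> \<theta> * y - \<kappa> * s < \<delta>}"

lemma characteristic_strip_measure:
  assumes \<theta>: "\<theta> \<in> {1, -1 :: real}" and T: "T \<ge> 0" and \<delta>: "\<delta> \<ge> 0"
  shows "characteristic_strip \<kappa> \<theta> T \<delta> \<in> finite_sets st_lebesgue"
    and "measure st_lebesgue (characteristic_strip \<kappa> \<theta> T \<delta>) = T * \<delta>"
proof -
  let ?S = "characteristic_strip \<kappa> \<theta> T \<delta>"
  have hp: "?S \<subseteq> half_plane" by (auto simp: characteristic_strip_def half_plane_def)
  have "?S = {p. 0 \<le> fst p \<and> fst p \<le> T} \<inter> {p. 0 < \<theta> * snd p - \<kappa> * fst p} \<inter> {p. \<theta> * snd p - \<kappa> * fst p < \<delta>}"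
    by (auto simp: characteristic_strip_def)
  also have "\<dots> \<in> sets borel"
  proof (intro sets.Int)
    show "{p :: real \<times> real. 0 \<le> fst p \<and> fst p \<le> T} \<in> sets borel"
      by (intro borel_closed closed_Collect_conj closed_Collect_le continuous_intros)
    show "{p :: real \<times> real. 0 < \<theta> * snd p - \<kappa> * fst p} \<in> sets borel"
      "{p :: real \<times> real. \<theta> * snd p - \<kappa> * fst p < \<delta>} \<in> sets borel"
      by (intro borel_open open_Collect_less continuous_intros)+
  qed
  finally have S: "?S \<in> sets borel" .
  have sec: "Pair s -` ?S = (if s \<in> {0..T}
      then (if \<theta> = 1 then {\<kappa> * s<..<\<kappa> * s + \<delta>} else {- \<kappa> * s - \<delta><..<- \<kappa> * s}) else {})" for s
    using \<theta> by (auto simp: characteristic_strip_def)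
  have "emeasure lborel ?S = emeasure (lborel \<Otimes>\<^sub>M lborel) ?S" by (simp add: lborel_prod)
  also have "\<dots> = (\<integral>\<^sup>+s. emeasure lborel (Pair s -` ?S) \<partial>lborel)"
    using S by (intro lborel.emeasure_pair_measure_alt) (simp only: lborel_prod sets_lborel)
  also have "\<dots> = (\<integral>\<^sup>+s. ennreal \<delta> * indicator {0..T} s \<partial>lborel)"
    using \<delta> by (intro nn_integral_cong) (auto simp: sec indicator_def)
  also have "\<dots> = ennreal \<delta> * ennreal T" using T by (simp add: nn_integral_cmult)
  finally have em: "emeasure lborel ?S = ennreal (T * \<delta>)" using T \<delta> by (simp add: ennreal_mult mult.commute)
  then show "?S \<in> finite_sets st_lebesgue"
    using S hp by (simp add: finite_sets_def sets_st_lebesgue emeasure_st_lebesgue)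
  show "measure st_lebesgue ?S = T * \<delta>"
    using em hp T \<delta> by (simp add: measure_def emeasure_st_lebesgue)
qed

text \<open>The strip is contained in the backward cone of \<open>(t\<^sub>0, x\<^sub>0)\<close> and disjoint from the backward cone of every
  point lying at least \<open>\<delta>\<close> outside the characteristic. The time bound \<open>t\<^sub>0 / 2\<close> leaves room for
  the opposite edge of the first cone.\<close>
lemma wave_kernel_strip:
  assumes \<theta>: "\<theta> \<in> {1, -1 :: real}" and \<kappa>: "\<kappa> > 0" and "x\<^sub>0 = \<theta> * \<kappa> * t\<^sub>0" and \<delta>: "\<delta> \<le> \<kappa> * t\<^sub>0"
    and s: "(s, y) \<in> characteristic_strip \<kappa> \<theta> (t\<^sub>0 / 2) \<delta>"
  shows "wave_kernel \<kappa> (t\<^sub>0 - s) (x\<^sub>0 - y) = 1 / 2"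
    and "\<theta> * x' - \<kappa> * t' \<ge> \<delta> \<Longrightarrow> wave_kernel \<kappa> (t' - s) (x' - y) = 0"
proof -
  have s: "0 \<le> s" "2 * s \<le> t\<^sub>0" "\<kappa> * s < \<theta> * y" "\<theta> * y < \<kappa> * s + \<delta>"
    using s by (auto simp: characteristic_strip_def)
  have ks: "2 * (\<kappa> * s) \<le> \<kappa> * t\<^sub>0" using mult_left_mono[OF s(2), of \<kappa>] \<kappa> by simp
  show "wave_kernel \<kappa> (t\<^sub>0 - s) (x\<^sub>0 - y) = 1 / 2"
    using assms(1,3) \<delta> s ks by (auto simp: wave_kernel_def indicator_def algebra_simps)
  show "wave_kernel \<kappa> (t' - s) (x' - y) = 0" if "\<theta> * x' - \<kappa> * t' \<ge> \<delta>"
    using assms(1) s ks that by (auto simp: wave_kernel_def indicator_def algebra_simps)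
qed

text \<open>One of the two terms of the homogeneous solution is evaluated within \<open>\<delta>\<close> of the origin, so it is
  at least \<open>\<delta> powr (- a)\<close>. The strip is open and on the outer side: neither term is
  evaluated at the origin itself, and the solution is finite at every point.\<close>
lemma wave_homogeneous_strip:
  assumes \<theta>: "\<theta> \<in> {1, -1 :: real}" and \<kappa>: "\<kappa> > 0" and a: "0 \<le> a"
    and s: "(s, y) \<in> characteristic_strip \<kappa> \<theta> T \<delta>"
  obtains r where "wave_homogeneous \<kappa> (abs_power_datum a) s y = ereal r" "r \<ge> \<delta> powr (- a) / 2"
proof -
  have s: "0 \<le> s" "0 < \<theta> * y - \<kappa> * s" "\<theta> * y - \<kappa> * s < \<delta>"
    using s by (auto simp: characteristic_strip_def)
  then have ks: "0 \<le> \<kappa> * s" using \<kappa> by simp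
  define g where "g x = (if a = 0 then 1 else \<bar>x\<bar> powr (- a))" for x :: real
  have g: "abs_power_datum a x = ereal (g x)" if "x \<noteq> 0" for x
    using that by (simp add: abs_power_datum_def g_def one_ereal_def)
  have g0: "g x \<ge> 0" for x by (simp add: g_def)
  have g1: "g x \<ge> \<delta> powr (- a)" if "x \<noteq> 0" "\<bar>x\<bar> < \<delta>" for x
    using that a by (auto simp: g_def intro: powr_mono2')
  have nz: "y + \<kappa> * s \<noteq> 0" "y - \<kappa> * s \<noteq> 0" using s ks \<theta> by auto
  have "wave_homogeneous \<kappa> (abs_power_datum a) s y = ereal ((g (y + \<kappa> * s) + g (y - \<kappa> * s)) / 2)"
    using nz by (simp add: wave_homogeneous_def g)
  moreover have "\<bar>y - \<kappa> * s\<bar> < \<delta> \<or> \<bar>y + \<kappa> * s\<bar> < \<delta>" using s \<theta> by auto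
  then have "(g (y + \<kappa> * s) + g (y - \<kappa> * s)) / 2 \<ge> \<delta> powr (- a) / 2"
    using g1[OF nz(1)] g1[OF nz(2)] g0[of "y + \<kappa> * s"] g0[of "y - \<kappa> * s"] by auto
  ultimately show ?thesis by (rule that)
qed

section \<open>Lower bound for the increments\<close>

context white_noise
begin

text \<open>Walsh integrals have mean zero, so the mean of the solution is the homogeneous part.\<close>
lemma expectation_diffusion_ge:
  assumes sol: "wave_solution M W \<kappa> \<rho> g u I" and s: "s \<ge> 0"
    and J0: "wave_homogeneous \<kappa> g s y = ereal r"
    and \<epsilon>: "\<And>v. \<epsilon> * \<rho> v \<ge> l * v" and cont: "continuous_on UNIV \<rho>"
    and sq: "\<And>v. \<bar>\<rho> v\<bar>\<^sup>2 = lam\<^sup>2 * (\<sigma>\<^sup>2 + v\<^sup>2)"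
  shows "expectation (\<lambda>\<omega>. \<epsilon> * \<rho> (u s y \<omega>)) \<ge> l * r"
proof -
  have "\<forall>t\<ge>0. \<forall>x. has_walsh_integral M W
      (\<lambda>s y \<omega>. indicator {0..t} s * wave_kernel \<kappa> (t - s) (x - y) * \<rho> (u s y \<omega>)) (I t x)"
    using sol unfolding wave_solution_def by (elim conjE)
  note walsh = this[rule_format, OF s, of y]
  have "\<forall>t\<ge>0. \<forall>x. u t x \<in> borel_measurable (\<F> t)"
    using sol unfolding wave_solution_def by (elim conjE)
  then have um: "u s y \<in> borel_measurable M" using s filtration_measurable by blast
  have fin: "\<bar>wave_homogeneous \<kappa> g s y\<bar> \<noteq> \<infinity>" using J0 by simp
  have "\<forall>t\<ge>0. \<forall>x. \<bar>wave_homogeneous \<kappa> g t x\<bar> \<noteq> \<infinity> \<longrightarrow>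
      (AE \<omega> in M. ereal (u t x \<omega>) = wave_homogeneous \<kappa> g t x + ereal (I t x \<omega>))"
    using sol unfolding wave_solution_def by (elim conjE)
  from this[rule_format, OF s fin]
  have ae: "AE \<omega> in M. ereal (u s y \<omega>) = wave_homogeneous \<kappa> g s y + ereal (I s y \<omega>)" .
  have empty: "{} \<in> FS" by (simp add: finite_sets_def)
  note I = walsh_integral_pairing(1,2)[OF walsh empty]
  have ae': "AE \<omega> in M. u s y \<omega> = r + I s y \<omega>" using ae J0 by simp
  have RI: "square_integrable M (\<lambda>\<omega>. r + I s y \<omega>)"
    by (rule square_integrable_add[OF square_integrable_const I(1)])
  have "integrable M (\<lambda>\<omega>. (u s y \<omega>)\<^sup>2) \<longleftrightarrow> integrable M (\<lambda>\<omega>. (r + I s y \<omega>)\<^sup>2)"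
  proof (rule integrable_cong_AE)
    show "AE \<omega> in M. (u s y \<omega>)\<^sup>2 = (r + I s y \<omega>)\<^sup>2" using ae' by eventually_elim simp
  qed (use um RI in \<open>auto simp: square_integrable_def\<close>)
  then have u2: "square_integrable M (u s y)" using um RI by (simp add: square_integrable_def)
  have Eu: "expectation (u s y) = r"
  proof -
    have "expectation (u s y) = expectation (\<lambda>\<omega>. r + I s y \<omega>)"
      using ae' um RI by (intro integral_cong_AE) (auto simp: square_integrable_def)
    also have "\<dots> = r" using I(2) square_integrable_integrable[OF I(1)] by (simp add: prob_space)
    finally show ?thesis .
  qed
  have "\<rho> \<in> borel_measurable borel" by (rule borel_measurable_continuous_onI[OF cont])
  then have \<rho>m: "(\<lambda>\<omega>. \<rho> (u s y \<omega>)) \<in> borel_measurable M" using um by simp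
  have "square_integrable M (\<lambda>\<omega>. \<rho> (u s y \<omega>))"
    unfolding square_integrable_def using \<rho>m u2 sq by (simp add: square_integrable_def)
  then have \<rho>i: "integrable M (\<lambda>\<omega>. \<rho> (u s y \<omega>))" by (rule square_integrable_integrable)
  have "l * r = expectation (\<lambda>\<omega>. l * u s y \<omega>)" using Eu by simp
  also have "\<dots> \<le> expectation (\<lambda>\<omega>. \<epsilon> * \<rho> (u s y \<omega>))"
    using \<rho>i square_integrable_integrable[OF u2] \<epsilon> by (intro integral_mono) auto
  finally show ?thesis .
qed

text \<open>The increment is tested against \<open>W S\<close>, where \<open>S\<close> is the strip separating the two cones. On \<open>S\<close> the
  difference of the kernels is \<open>1/2\<close> and the mean of \<open>\<rho> (u s y)\<close> is of order \<open>\<delta> powr (- a)\<close>, with a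
  constant sign. So the pairing is at least of order \<open>\<delta> powr (- a)\<close> times the area of \<open>S\<close>, which
  is of order \<open>\<delta>\<close>, while \<open>W S\<close> has the area as its variance; Cauchy--Schwarz gives the exponent.\<close>
lemma increment_lower_bound:
  assumes sol: "wave_solution M W \<kappa> \<rho> (abs_power_datum a) u I"
    and \<kappa>: "\<kappa> > 0" and a: "0 \<le> a" and t\<^sub>0: "t\<^sub>0 > 0"
    and \<theta>: "\<theta> \<in> {1, -1}" and x\<^sub>0: "x\<^sub>0 = \<theta> * \<kappa> * t\<^sub>0"
    and lam: "lam \<noteq> 0" and cont: "continuous_on UNIV \<rho>"
    and sq: "\<And>v. \<bar>\<rho> v\<bar>\<^sup>2 = lam\<^sup>2 * (\<sigma>\<^sup>2 + v\<^sup>2)"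
    and \<delta>: "0 < \<delta>" "\<delta> \<le> \<kappa> * t\<^sub>0" and t': "t' \<ge> 0" and out: "\<theta> * x' - \<kappa> * t' \<ge> \<delta>"
  shows "square_integrable M (\<lambda>\<omega>. I t\<^sub>0 x\<^sub>0 \<omega> - I t' x' \<omega>)"
    and "expectation (\<lambda>\<omega>. (I t\<^sub>0 x\<^sub>0 \<omega> - I t' x' \<omega>)\<^sup>2)
      \<ge> (\<bar>lam\<bar> / 4)\<^sup>2 * (t\<^sub>0 / 2) * \<delta> powr (1 - 2 * a)"
proof -
  interpret P: pair_sigma_finite st_lebesgue M by (rule pair_sigma_finite_st)
  define S where "S = characteristic_strip \<kappa> \<theta> (t\<^sub>0 / 2) \<delta>"
  have S: "S \<in> FS" and mS: "measure st_lebesgue S = t\<^sub>0 / 2 * \<delta>"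
    unfolding S_def using characteristic_strip_measure[OF \<theta>, of "t\<^sub>0 / 2" \<delta> \<kappa>] t\<^sub>0 \<delta> by auto
  define f where "f t x s y \<omega> = indicator {0..t} s * wave_kernel \<kappa> (t - s) (x - y) * \<rho> (u s y \<omega>)"
    for t x s y \<omega>
  have walsh: "has_walsh_integral M W (f t x) (I t x)" if "t \<ge> 0" for t x
    using sol that unfolding wave_solution_def f_def by blast
  note p0 = walsh_integral_pairing[OF walsh[OF less_imp_le[OF t\<^sub>0], of x\<^sub>0] S]
  note p1 = walsh_integral_pairing[OF walsh[OF t', of x'] S]
  show L2: "square_integrable M (\<lambda>\<omega>. I t\<^sub>0 x\<^sub>0 \<omega> - I t' x' \<omega>)"
    by (rule square_integrable_diff[OF p0(1) p1(1)])
  obtain \<epsilon> where \<epsilon>: "\<epsilon> \<in> {1, -1}" "\<And>v. \<epsilon> * \<rho> v \<ge> \<bar>lam\<bar> * v"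
    using sign_dominates_linear[OF cont sq lam] by blast
  define D where "D x = (f t\<^sub>0 x\<^sub>0 (fst (fst x)) (snd (fst x)) (snd x) - f t' x' (fst (fst x)) (snd (fst x)) (snd x))
      * indicator S (fst x)" for x
  note z = indicator_square_integrable[OF S]
  note pm = square_integrable_mult[OF p0(1) W_square_integrable[OF S]]
    square_integrable_mult[OF p1(1) W_square_integrable[OF S]]
    square_integrable_mult[OF p0(3) z] square_integrable_mult[OF p1(3) z]
  have Di: "integrable \<P> D"
    unfolding D_def using pm(3,4) by (simp add: left_diff_distrib)
  have pair: "expectation (\<lambda>\<omega>. (I t\<^sub>0 x\<^sub>0 \<omega> - I t' x' \<omega>) * W S \<omega>) = (\<integral>x. D x \<partial>\<P>)"
    unfolding D_def using pm p0(4) p1(4) by (simp add: left_diff_distrib)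
  define c where "c = \<bar>lam\<bar> / 4 * \<delta> powr (- a)"
  have c0: "c \<ge> 0" by (simp add: c_def)
  \<comment> \<open>Here \<open>1/4\<close> in \<open>c\<close> is \<open>1/2\<close> from the kernel times \<open>1/2\<close> from the homogeneous solution.\<close>
  have point: "c * indicator S p \<le> (\<integral>\<omega>. \<epsilon> * D (p, \<omega>) \<partial>M)" for p
  proof (cases "p \<in> S")
    case False
    then show ?thesis by (simp add: D_def)
  next
    case True
    obtain s y where p: "p = (s, y)" by (cases p)
    have sy: "(s, y) \<in> characteristic_strip \<kappa> \<theta> (t\<^sub>0 / 2) \<delta>" using True p by (simp add: S_def)
    then have s: "0 \<le> s" "s \<le> t\<^sub>0 / 2" by (auto simp: characteristic_strip_def)
    obtain r where r: "wave_homogeneous \<kappa> (abs_power_datum a) s y = ereal r" "r \<ge> \<delta> powr (- a) / 2"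
      using wave_homogeneous_strip[OF \<theta> \<kappa> a sy] .
    have "c \<le> 1 / 2 * (\<bar>lam\<bar> * r)"
      using mult_left_mono[OF r(2), of "\<bar>lam\<bar> / 2"] by (simp add: c_def)
    also have "\<dots> \<le> 1 / 2 * expectation (\<lambda>\<omega>. \<epsilon> * \<rho> (u s y \<omega>))"
      by (intro mult_left_mono expectation_diffusion_ge[OF sol s(1) r(1) \<epsilon>(2) cont sq]) auto
    also have "\<dots> = (\<integral>\<omega>. 1 / 2 * (\<epsilon> * \<rho> (u s y \<omega>)) \<partial>M)" by simp
    also have "\<dots> = (\<integral>\<omega>. \<epsilon> * D (p, \<omega>) \<partial>M)"
    proof (rule Bochner_Integration.integral_cong)
      show "1 / 2 * (\<epsilon> * \<rho> (u s y \<omega>)) = \<epsilon> * D (p, \<omega>)" for \<omega>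
        using wave_kernel_strip[OF \<theta> \<kappa> x\<^sub>0 \<delta>(2) sy] out s t\<^sub>0 True
        by (simp add: D_def f_def p)
    qed simp
    finally show ?thesis using True by simp
  qed
  have fS: "S \<in> sets st_lebesgue" "emeasure st_lebesgue S < \<infinity>" using S by (auto simp: finite_sets_def)
  have \<epsilon>D: "integrable \<P> (\<lambda>x. \<epsilon> * D x)" using Di by simp
  have "c * (t\<^sub>0 / 2 * \<delta>) = (\<integral>p. c * indicator S p \<partial>st_lebesgue)"
    using fS mS by simp
  also have "\<dots> \<le> (\<integral>p. (\<integral>\<omega>. \<epsilon> * D (p, \<omega>) \<partial>M) \<partial>st_lebesgue)"
    using fS point P.integrable_fst'[OF \<epsilon>D] by (intro integral_mono) auto
  also have "\<dots> = (\<integral>x. \<epsilon> * D x \<partial>\<P>)" by (rule P.integral_fst'[OF \<epsilon>D])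
  also have "\<dots> = \<epsilon> * expectation (\<lambda>\<omega>. (I t\<^sub>0 x\<^sub>0 \<omega> - I t' x' \<omega>) * W S \<omega>)"
    unfolding pair by simp
  finally have low: "c * (t\<^sub>0 / 2 * \<delta>) \<le> \<epsilon> * expectation (\<lambda>\<omega>. (I t\<^sub>0 x\<^sub>0 \<omega> - I t' x' \<omega>) * W S \<omega>)" .
  define E where "E = expectation (\<lambda>\<omega>. (I t\<^sub>0 x\<^sub>0 \<omega> - I t' x' \<omega>)\<^sup>2)"
  have "(c * (t\<^sub>0 / 2 * \<delta>))\<^sup>2 \<le> (\<epsilon> * expectation (\<lambda>\<omega>. (I t\<^sub>0 x\<^sub>0 \<omega> - I t' x' \<omega>) * W S \<omega>))\<^sup>2"
    using low c0 t\<^sub>0 \<delta> by (intro power_mono) auto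
  also have "\<dots> = (expectation (\<lambda>\<omega>. (I t\<^sub>0 x\<^sub>0 \<omega> - I t' x' \<omega>) * W S \<omega>))\<^sup>2"
    using \<epsilon>(1) by auto
  also have "\<dots> \<le> E * expectation (\<lambda>\<omega>. (W S \<omega>)\<^sup>2)"
    unfolding E_def by (rule integral_Cauchy_Schwarz[OF L2 W_square_integrable[OF S]])
  also have "expectation (\<lambda>\<omega>. (W S \<omega>)\<^sup>2) = t\<^sub>0 / 2 * \<delta>"
    using W_covariance[OF S S] mS by (simp add: power2_eq_square)
  finally have "c\<^sup>2 * (t\<^sub>0 / 2 * \<delta>) * (t\<^sub>0 / 2 * \<delta>) \<le> E * (t\<^sub>0 / 2 * \<delta>)"
    by (simp add: power2_eq_square algebra_simps)
  then have "c\<^sup>2 * (t\<^sub>0 / 2 * \<delta>) \<le> E"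
    using t\<^sub>0 \<delta> by (subst (asm) mult_le_cancel_right) auto
  moreover have "c\<^sup>2 * (t\<^sub>0 / 2 * \<delta>) = (\<bar>lam\<bar> / 4)\<^sup>2 * (t\<^sub>0 / 2) * \<delta> powr (1 - 2 * a)"
  proof -
    have "(\<delta> powr (- a))\<^sup>2 * \<delta> = \<delta> powr (1 - 2 * a)"
      using \<delta> by (simp add: power2_eq_square powr_add[symmetric] powr_mult_base algebra_simps)
    moreover have "c\<^sup>2 * (t\<^sub>0 / 2 * \<delta>) = (\<bar>lam\<bar> / 4)\<^sup>2 * (t\<^sub>0 / 2) * ((\<delta> powr (- a))\<^sup>2 * \<delta>)"
      by (simp only: c_def power_mult_distrib ac_simps)
    ultimately show ?thesis by simp
  qed
  ultimately show "expectation (\<lambda>\<omega>. (I t\<^sub>0 x\<^sub>0 \<omega> - I t' x' \<omega>)\<^sup>2)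
      \<ge> (\<bar>lam\<bar> / 4)\<^sup>2 * (t\<^sub>0 / 2) * \<delta> powr (1 - 2 * a)"
    unfolding E_def by (simp only:)
qed

text \<open>Integrates \<open>v\<^sup>2 \<le> K\<^sup>2 + K powr (2 - p) * \<bar>v\<bar> powr p\<close>, which holds because one of the two terms
  dominates according to whether \<open>\<bar>v\<bar> \<le> K\<close>. The factor 2 lost against Jensen's inequality is
  harmless for comparing powers.\<close>
lemma second_moment_le_Lp_norm:
  assumes X: "square_integrable M X" and p: "p \<ge> 2" and K: "K > 0"
    and le: "Lp_norm M p X \<le> ennreal K"
  shows "expectation (\<lambda>\<omega>. (X \<omega>)\<^sup>2) \<le> 2 * K\<^sup>2"
proof -
  define m where "m = (\<integral>\<^sup>+\<omega>. ennreal (\<bar>X \<omega>\<bar> powr p) \<partial>M)"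
  have fin: "m \<noteq> \<infinity>"
    using le by (auto simp: Lp_norm_def m_def[symmetric] Let_def top_unique split: if_splits)
  then have "enn2real m powr (1 / p) \<le> K"
    using le K by (simp add: Lp_norm_def m_def[symmetric] Let_def)
  then have "(enn2real m powr (1 / p)) powr p \<le> K powr p"
    using p by (intro powr_mono2) auto
  then have mK: "enn2real m \<le> K powr p" using p by (simp add: powr_powr)
  have Xm: "X \<in> borel_measurable M" using X by (simp add: square_integrable_def)
  have Xi: "integrable M (\<lambda>\<omega>. \<bar>X \<omega>\<bar> powr p)"
    using Xm fin unfolding m_def by (intro integrableI_nonneg) (auto simp: top.not_eq_extremum)
  have Em: "expectation (\<lambda>\<omega>. \<bar>X \<omega>\<bar> powr p) = enn2real m"
    unfolding m_def using Xm by (intro integral_eq_nn_integral) auto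
  have pt: "v\<^sup>2 \<le> K\<^sup>2 + K powr (2 - p) * \<bar>v\<bar> powr p" for v :: real
  proof (cases "\<bar>v\<bar> \<le> K")
    case True
    then have "v\<^sup>2 \<le> K\<^sup>2" using abs_le_square_iff[of v K] K by simp
    then show ?thesis by (simp add: add_increasing2)
  next
    case False
    then have v: "\<bar>v\<bar> > 0" "K \<le> \<bar>v\<bar>" using K by auto
    have "v\<^sup>2 = \<bar>v\<bar> powr (2 - p) * \<bar>v\<bar> powr p"
      using v by (simp add: powr_add[symmetric])
    also have "\<dots> \<le> K powr (2 - p) * \<bar>v\<bar> powr p"
      using v K p by (intro mult_right_mono powr_mono2') auto
    finally show ?thesis by (simp add: add_increasing)
  qed
  have "expectation (\<lambda>\<omega>. (X \<omega>)\<^sup>2) \<le> expectation (\<lambda>\<omega>. K\<^sup>2 + K powr (2 - p) * \<bar>X \<omega>\<bar> powr p)"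
    using X Xi pt by (intro integral_mono) (auto simp: square_integrable_def)
  also have "\<dots> = K\<^sup>2 + K powr (2 - p) * enn2real m"
    using Xi Em by (simp add: prob_space)
  also have "\<dots> \<le> K\<^sup>2 + K powr (2 - p) * K powr p"
    using mK by (intro add_left_mono mult_left_mono) auto
  also have "\<dots> = 2 * K\<^sup>2" using K by (simp add: powr_add[symmetric])
  finally show ?thesis .
qed

end

section \<open>Failure of Hoelder continuity\<close>

text \<open>Dividing by \<open>\<delta> powr (2 * \<alpha>)\<close> would otherwise leave a positive constant below a quantity tending to
  zero.\<close>
lemma holder_exponent_bound:
  fixes A B \<alpha> \<eta> :: real
  assumes A: "A > 0" and ev: "\<forall>\<^sub>F \<delta> in at_right 0. A * \<delta> powr (2 * \<alpha>) \<le> B * \<delta> powr (2 * \<eta>)"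
  shows "\<eta> \<le> \<alpha>"
proof (rule ccontr)
  assume "\<not> \<eta> \<le> \<alpha>"
  then have pos: "2 * (\<eta> - \<alpha>) > 0" by simp
  have "((\<lambda>\<delta>. B * \<delta> powr (2 * (\<eta> - \<alpha>))) \<longlongrightarrow> B * 0) (at_right 0)"
  proof (intro tendsto_mult_left)
    have "((\<lambda>\<delta>::real. \<delta> powr (2 * (\<eta> - \<alpha>))) \<longlongrightarrow> 0 powr (2 * (\<eta> - \<alpha>))) (at_right 0)"
      using pos by (intro tendsto_powr2 tendsto_intros) (auto simp: eventually_at_right_less
          intro: eventually_mono[OF eventually_at_right_less])
    then show "((\<lambda>\<delta>::real. \<delta> powr (2 * (\<eta> - \<alpha>))) \<longlongrightarrow> 0) (at_right 0)" using pos by simp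
  qed
  then have "\<forall>\<^sub>F \<delta> in at_right 0. B * \<delta> powr (2 * (\<eta> - \<alpha>)) < A"
    using A by (intro order_tendstoD) auto
  then have "\<forall>\<^sub>F \<delta> in at_right (0::real). False"
    using ev eventually_at_right_less[of "0::real"]
  proof eventually_elim
    case (elim \<delta>)
    have "A * \<delta> powr (2 * \<alpha>) \<le> B * \<delta> powr (2 * (\<eta> - \<alpha>)) * \<delta> powr (2 * \<alpha>)"
      using elim by (simp add: powr_add[symmetric] mult.assoc right_diff_distrib)
    then have "A \<le> B * \<delta> powr (2 * (\<eta> - \<alpha>))" using elim by simp
    then show False using elim by simp
  qed
  then show False by (simp add: trivial_limit_at_right_real)
qed

theorem proposition4p2:
  fixes M :: "'a measure"
    and W :: "(real \<times> real) set \<Rightarrow> 'a \<Rightarrow> real"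
    and \<kappa> a lam \<sigma> :: real
    and \<rho> :: "real \<Rightarrow> real"
    and u I :: "real \<Rightarrow> real \<Rightarrow> 'a \<Rightarrow> real"
  assumes "prob_space M"
    and "space_time_white_noise M W"
    and "\<kappa> > 0"
    and "\<exists>L. L-lipschitz_on UNIV \<rho>"
    and "\<And>v. \<bar>\<rho> v\<bar>\<^sup>2 = lam\<^sup>2 * (\<sigma>\<^sup>2 + v\<^sup>2)"
    and "lam \<noteq> 0" and "\<sigma> \<ge> 0"
    and "0 \<le> a" and "a < 1 / 2"
    and "wave_solution M W \<kappa> \<rho> (abs_power_datum a) u I"
  shows "\<forall>p\<ge>2. \<forall>\<eta>>(1 - 2 * a) / 2. \<forall>t\<^sub>0>0. \<forall>x\<^sub>0. \<bar>x\<^sub>0\<bar> = \<kappa> * t\<^sub>0 \<longrightarrow>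
    (\<forall>U\<subseteq>half_plane. (\<exists>V. open V \<and> (t\<^sub>0, x\<^sub>0) \<in> V \<and> V \<inter> half_plane \<subseteq> U) \<longrightarrow>
       \<not> holder_in_space M p \<eta> U I \<and> \<not> holder_in_time M p \<eta> U I)"
proof (intro allI impI)
  fix p \<eta> t\<^sub>0 x\<^sub>0 :: real and U :: "(real \<times> real) set"
  assume p: "p \<ge> 2" and \<eta>: "\<eta> > (1 - 2 * a) / 2" and t\<^sub>0: "t\<^sub>0 > 0" and x\<^sub>0: "\<bar>x\<^sub>0\<bar> = \<kappa> * t\<^sub>0"
    and "\<exists>V. open V \<and> (t\<^sub>0, x\<^sub>0) \<in> V \<and> V \<inter> half_plane \<subseteq> U"
  then obtain V where V: "open V" "(t\<^sub>0, x\<^sub>0) \<in> V" "V \<inter> half_plane \<subseteq> U" by blast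
  interpret white_noise M W
    using assms(1,2) by (simp add: white_noise_def white_noise_axioms_def)
  note \<kappa> = assms(3)
  define \<theta> :: real where "\<theta> = sgn x\<^sub>0"
  have "x\<^sub>0 \<noteq> 0" using x\<^sub>0 \<kappa> t\<^sub>0 by auto
  then have \<theta>: "\<theta> \<in> {1, -1}" by (auto simp: \<theta>_def sgn_if)
  have x\<^sub>0': "x\<^sub>0 = \<theta> * \<kappa> * t\<^sub>0" using sgn_mult_abs[of x\<^sub>0] x\<^sub>0 by (simp add: \<theta>_def mult.assoc)
  have \<theta>\<theta>: "\<theta> * \<theta> = 1" "\<bar>\<theta>\<bar> = 1" using \<theta> by auto
  have cont: "continuous_on UNIV \<rho>"
    using assms(4) lipschitz_on_continuous_on by blast
  have U\<^sub>0: "(t\<^sub>0, x\<^sub>0) \<in> U" using V t\<^sub>0 by (auto simp: half_plane_def)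
  note low = increment_lower_bound[OF assms(10) \<kappa> assms(8) t\<^sub>0 \<theta> x\<^sub>0' assms(6) cont assms(5)]
  \<comment> \<open>Both increments are covered by a curve \<open>(t' \<delta>, x' \<delta>)\<close> that leaves the characteristic at distance \<open>\<delta>\<close>.\<close>
  have contradiction: False
    if C: "C \<ge> 0"
      and q: "((\<lambda>\<delta>. (t' \<delta>, x' \<delta>)) \<longlongrightarrow> (t\<^sub>0, x\<^sub>0)) (at_right 0)"
      and out: "\<And>\<delta>. \<theta> * x' \<delta> - \<kappa> * t' \<delta> = \<delta>"
      and le: "\<And>\<delta>. \<delta> > 0 \<Longrightarrow> (t' \<delta>, x' \<delta>) \<in> U \<Longrightarrow>
        Lp_norm M p (\<lambda>\<omega>. I t\<^sub>0 x\<^sub>0 \<omega> - I (t' \<delta>) (x' \<delta>) \<omega>) \<le> ennreal (C * \<delta> powr \<eta>)"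
    for C :: real and t' x' :: "real \<Rightarrow> real"
  proof -
    have A: "(\<bar>lam\<bar> / 4)\<^sup>2 * (t\<^sub>0 / 2) > 0" using assms(6) t\<^sub>0 by simp
    have "\<forall>\<^sub>F \<delta> in at_right 0. (t' \<delta>, x' \<delta>) \<in> V" using q V(1,2) by (rule topological_tendstoD)
    moreover have "\<forall>\<^sub>F \<delta> in at_right 0. t' \<delta> > 0"
      using tendsto_fst[OF q] t\<^sub>0 by (intro order_tendstoD) auto
    moreover have "\<forall>\<^sub>F \<delta> in at_right 0. \<delta> < \<kappa> * t\<^sub>0"
      using \<kappa> t\<^sub>0 by (intro order_tendstoD[OF tendsto_ident_at]) auto
    ultimately have "\<forall>\<^sub>F \<delta> in at_right 0. (\<bar>lam\<bar> / 4)\<^sup>2 * (t\<^sub>0 / 2) * \<delta> powr (2 * ((1 - 2 * a) / 2))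
        \<le> (2 * (C + 1)\<^sup>2) * \<delta> powr (2 * \<eta>)"
      using eventually_at_right_less[of "0::real"]
    proof eventually_elim
      case (elim \<delta>)
      then have \<delta>: "0 < \<delta>" "\<delta> \<le> \<kappa> * t\<^sub>0" "0 \<le> t' \<delta>" "\<theta> * x' \<delta> - \<kappa> * t' \<delta> \<ge> \<delta>"
        using out by auto
      have "(t' \<delta>, x' \<delta>) \<in> U" using elim V(3) by (auto simp: half_plane_def)
      from le[OF \<delta>(1) this]
      \<comment> \<open>The constant is raised to \<open>C + 1\<close> to make the bound strictly positive.\<close>
      have "Lp_norm M p (\<lambda>\<omega>. I t\<^sub>0 x\<^sub>0 \<omega> - I (t' \<delta>) (x' \<delta>) \<omega>) \<le> ennreal ((C + 1) * \<delta> powr \<eta>)"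
        by (rule order_trans) (intro ennreal_leI mult_right_mono, auto)
      from second_moment_le_Lp_norm[OF low(1)[OF \<delta>] p _ this]
      have "expectation (\<lambda>\<omega>. (I t\<^sub>0 x\<^sub>0 \<omega> - I (t' \<delta>) (x' \<delta>) \<omega>)\<^sup>2) \<le> 2 * ((C + 1) * \<delta> powr \<eta>)\<^sup>2"
        using C \<delta>(1) by simp
      also have "\<dots> = (2 * (C + 1)\<^sup>2) * \<delta> powr (2 * \<eta>)"
        using \<delta>(1) by (simp add: power_mult_distrib power2_eq_square powr_add[symmetric])
      finally have up: "expectation (\<lambda>\<omega>. (I t\<^sub>0 x\<^sub>0 \<omega> - I (t' \<delta>) (x' \<delta>) \<omega>)\<^sup>2)
        \<le> (2 * (C + 1)\<^sup>2) * \<delta> powr (2 * \<eta>)" .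
      have half: "2 * ((1 - 2 * a) / 2) = 1 - 2 * a" by simp
      show ?case unfolding half using low(2)[OF \<delta>] up by (rule order_trans)
    qed
    from holder_exponent_bound[OF A this] \<eta> show False by simp
  qed
  show "\<not> holder_in_space M p \<eta> U I \<and> \<not> holder_in_time M p \<eta> U I"
  proof
    show "\<not> holder_in_space M p \<eta> U I"
    proof
      assume "holder_in_space M p \<eta> U I"
      then obtain C where C: "C \<ge> 0" "\<And>t x x'. (t, x) \<in> U \<Longrightarrow> (t, x') \<in> U \<Longrightarrow>
          Lp_norm M p (\<lambda>\<omega>. I t x \<omega> - I t x' \<omega>) \<le> ennreal (C * \<bar>x - x'\<bar> powr \<eta>)"
        unfolding holder_in_space_def by blast
      show False
      proof (rule contradiction[OF C(1)])
        show "((\<lambda>\<delta>. (t\<^sub>0, x\<^sub>0 + \<theta> * \<delta>)) \<longlongrightarrow> (t\<^sub>0, x\<^sub>0)) (at_right 0)"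
          by (auto intro!: tendsto_eq_intros)
        show "\<theta> * (x\<^sub>0 + \<theta> * \<delta>) - \<kappa> * t\<^sub>0 = \<delta>" for \<delta>
          using \<theta> by (auto simp: x\<^sub>0')
        show "Lp_norm M p (\<lambda>\<omega>. I t\<^sub>0 x\<^sub>0 \<omega> - I t\<^sub>0 (x\<^sub>0 + \<theta> * \<delta>) \<omega>) \<le> ennreal (C * \<delta> powr \<eta>)"
          if "\<delta> > 0" "(t\<^sub>0, x\<^sub>0 + \<theta> * \<delta>) \<in> U" for \<delta>
          using C(2)[OF U\<^sub>0 that(2)] that(1) \<theta>\<theta> by (simp add: abs_mult)
      qed
    qed
    show "\<not> holder_in_time M p \<eta> U I"
    proof
      assume "holder_in_time M p \<eta> U I"
      then obtain C where C: "C \<ge> 0" "\<And>t t' x. (t, x) \<in> U \<Longrightarrow> (t', x) \<in> U \<Longrightarrow>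
          Lp_norm M p (\<lambda>\<omega>. I t x \<omega> - I t' x \<omega>) \<le> ennreal (C * \<bar>t - t'\<bar> powr \<eta>)"
        unfolding holder_in_time_def by blast
      have C': "C * (1 / \<kappa>) powr \<eta> \<ge> 0" using C(1) by simp
      show False
      proof (rule contradiction[OF C'])
        show "((\<lambda>\<delta>. (t\<^sub>0 - \<delta> / \<kappa>, x\<^sub>0)) \<longlongrightarrow> (t\<^sub>0, x\<^sub>0)) (at_right 0)"
          using \<kappa> by (auto intro!: tendsto_eq_intros)
        show "\<theta> * x\<^sub>0 - \<kappa> * (t\<^sub>0 - \<delta> / \<kappa>) = \<delta>" for \<delta>
          using \<theta> \<kappa> by (auto simp: x\<^sub>0' right_diff_distrib)
        show "Lp_norm M p (\<lambda>\<omega>. I t\<^sub>0 x\<^sub>0 \<omega> - I (t\<^sub>0 - \<delta> / \<kappa>) x\<^sub>0 \<omega>) \<le> ennreal (C * (1 / \<kappa>) powr \<eta> * \<delta> powr \<eta>)"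
          if "\<delta> > 0" "(t\<^sub>0 - \<delta> / \<kappa>, x\<^sub>0) \<in> U" for \<delta>
          using C(2)[OF U\<^sub>0 that(2)] that(1) \<kappa> by (simp add: powr_divide mult.assoc)
      qed
    qed
  qed
qed

end
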